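(* Let $a,p\in[0,1]$ and let $W:[0,1]^2\to[0,1]$ be the graphon which is $0$ on $[0,a)^2$, $1$ on $[a,1]^2$, and $p$ everywhere else. Then $W$ is forced by the sequence $(X_k)_{k\in\mathbb N}$; that is, every graphon $U$ such that for every $k\in\mathbb N$ the random variables $X_k(U)$ and $X_k(W)$ have the same distribution is weakly isomorphic to $W$.
   Context: A graphon is a measurable symmetric function $W:[0,1]^2\to[0,1]$ (Lebesgue measure on $[0,1]$). For an integer $k\ge 1$, the $k$-sample $\mathbb G(k,W)$ is the random graph on $\{1,\dots,k\}$ obtained by sampling $x_1,\dots,x_k\in[0,1]$ uniformly at random and making each pair $\{i,j\}\subseteq\{1,\dots,k\}$ with $i\ne j$ an edge with probability $W(x_i,x_j)$, all these choices being mutually independent. $X_k(W)$ denotes the number of edges of $\mathbb G(k,W)$. Two graphons $U,W$ are weakly isomorphic if $\mathbb G(k,U)$ and $\mathbb G(k,W)$ have the same distribution for every $k\in\mathbb N$. *)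

theory Defs
  imports "HOL-Probability.Probability"
begin

text \<open>
  Only the values on the unit square matter; measurability is Lebesgue measurability there.
\<close>
definition graphon :: "(real \<Rightarrow> real \<Rightarrow> real) \<Rightarrow> bool" where
  "graphon W \<longleftrightarrow>
     case_prod W \<in> borel_measurable (lebesgue_on ({0..1} \<times> {0..1})) \<and>
     (\<forall>x\<in>{0..1}. \<forall>y\<in>{0..1}. W x y = W y x) \<and>
     (\<forall>x\<in>{0..1}. \<forall>y\<in>{0..1}. W x y \<in> {0..1})"

definition vertex_pairs :: "nat \<Rightarrow> (nat \<times> nat) set" where
  "vertex_pairs k = {(i, j). i \<in> {1..k} \<and> j \<in> {1..k} \<and> i < j}"

text \<open>
  A graph on the vertex set \<open>{1..k}\<close> is represented by its set of edges, an edge being a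
  two-element set of vertices.  Each pair \<open>i < j\<close> is an edge independently with
  probability \<open>q i j\<close>.
\<close>
definition random_graph_pmf :: "nat \<Rightarrow> (nat \<Rightarrow> nat \<Rightarrow> real) \<Rightarrow> nat set set pmf" where
  "random_graph_pmf k q =
     map_pmf (\<lambda>f. (\<lambda>(i, j). {i, j}) ` {e \<in> vertex_pairs k. f e})
       (Pi_pmf (vertex_pairs k) False (\<lambda>(i, j). bernoulli_pmf (q i j)))"

text \<open>
  The completion is needed because \<open>W\<close> is only Lebesgue measurable, so that
  \<open>x \<mapsto> W (x i) (x j)\<close> need not be measurable for the product \<open>\<sigma>\<close>-algebra itself.
  With it, the kernel in the sampling below is measurable for every graphon, so the Giry bind
  is the genuine mixture.
\<close>
definition uniform_points :: "nat \<Rightarrow> (nat \<Rightarrow> real) measure" where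
  "uniform_points k = completion (\<Pi>\<^sub>M i\<in>{1..k}. uniform_measure lborel {0..1})"

definition graphon_sample :: "nat \<Rightarrow> (real \<Rightarrow> real \<Rightarrow> real) \<Rightarrow> nat set set measure" where
  "graphon_sample k W =
     uniform_points k \<bind> (\<lambda>x. measure_pmf (random_graph_pmf k (\<lambda>i j. W (x i) (x j))))"

definition edge_count_distribution :: "nat \<Rightarrow> (real \<Rightarrow> real \<Rightarrow> real) \<Rightarrow> nat measure" where
  "edge_count_distribution k W = distr (graphon_sample k W) (count_space UNIV) card"

definition weakly_isomorphic ::
    "(real \<Rightarrow> real \<Rightarrow> real) \<Rightarrow> (real \<Rightarrow> real \<Rightarrow> real) \<Rightarrow> bool" where
  "weakly_isomorphic U W \<longleftrightarrow> (\<forall>k\<ge>1. graphon_sample k U = graphon_sample k W)"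

definition forced_by_edge_counts :: "(real \<Rightarrow> real \<Rightarrow> real) \<Rightarrow> bool" where
  "forced_by_edge_counts W \<longleftrightarrow>
     (\<forall>U. graphon U \<longrightarrow>
        (\<forall>k\<ge>1. edge_count_distribution k U = edge_count_distribution k W) \<longrightarrow>
        weakly_isomorphic U W)"

end

theory Submission
  imports Defs
begin

text \<open>
  For weights \<open>s\<close> and \<open>t\<close>, the expectation of \<open>s ^ X * t ^ (N - X)\<close>, with \<open>X\<close> the edge count of the
  \<open>k\<close>-sample of \<open>U\<close> and \<open>N = k choose 2\<close>, is the \<open>K\<^sub>k\<close>-density of the kernel \<open>s U + t (1 - U)\<close>. So all
  these densities agree for \<open>U\<close> and \<open>W\<close>.

  The \<open>K\<^sub>k\<close>-densities of \<open>U\<close> and \<open>1 - U\<close> are at least \<open>(1 - a) ^ k\<close> and \<open>a ^ k\<close>. A kernel bounded by 1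
  whose \<open>K\<^sub>k\<close>-densities are at least \<open>b ^ k\<close> for all \<open>k\<close> equals 1 on some \<open>B \<times> B\<close> with \<open>B\<close> of measure at
  least \<open>b\<close>. This gives sets \<open>B\<close> and \<open>A\<close> of measure at least \<open>1 - a\<close> and \<open>a\<close> on whose squares \<open>U\<close> is 1
  and 0. They meet in a null set, so they partition the interval.

  On \<open>A \<times> B\<close>, the cases \<open>k = 2, 3\<close> for \<open>U\<close> and \<open>1 - U\<close> fix the first two moments of the degrees, which
  are therefore constant. Then \<open>k = 4\<close> for \<open>1 + U\<close> fixes the density of the four-cycle, which is the
  second moment of the codegrees; so these are constant too, hence \<open>U = p\<close> almost everywhere.
\<close>

section \<open>Pairs of vertices\<close>

lemma finite_vertex_pairs [simp]: "finite (vertex_pairs k)"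
  by (rule finite_subset[of _ "{1..k} \<times> {1..k}"]) (auto simp: vertex_pairs_def)

lemma vertex_pairs_0 [simp]: "vertex_pairs 0 = {}"
  by (auto simp: vertex_pairs_def)

lemma vertex_pairs_Suc: "vertex_pairs (Suc k) = vertex_pairs k \<union> (\<lambda>i. (i, Suc k)) ` {1..k}"
  by (auto simp: vertex_pairs_def)

lemma prod_vertex_pairs_Suc:
  fixes g :: "nat \<times> nat \<Rightarrow> 'b::comm_monoid_mult"
  shows "(\<Prod>e\<in>vertex_pairs (Suc k). g e) = (\<Prod>e\<in>vertex_pairs k. g e) * (\<Prod>i\<in>{1..k}. g (i, Suc k))"
  unfolding vertex_pairs_Suc
  by (subst prod.union_disjoint)
    (auto simp: vertex_pairs_def prod.reindex inj_on_def
      intro: finite_subset[of _ "{1..k} \<times> {1..k}"])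

lemma card_vertex_pairs: "card (vertex_pairs k) = k choose 2"
proof (induction k)
  case (Suc k)
  have "card (vertex_pairs (Suc k)) = card (vertex_pairs k) + card ((\<lambda>i. (i, Suc k)) ` {1..k})"
    unfolding vertex_pairs_Suc
    by (rule card_Un_disjoint) (auto simp: vertex_pairs_def intro: finite_subset[of _ "{1..k} \<times> {1..k}"])
  also have "card ((\<lambda>i. (i, Suc k)) ` {1..k}) = k"
    by (subst card_image) (auto simp: inj_on_def)
  finally show ?case using Suc by (simp add: numeral_2_eq_2)
qed simp

section \<open>Weighted clique densities of a kernel\<close>

locale sym_kernel = prob_space M for M :: "'a measure" +
  fixes q :: "'a \<Rightarrow> 'a \<Rightarrow> ennreal"
  assumes q_measurable [measurable]: "case_prod q \<in> borel_measurable (M \<Otimes>\<^sub>M M)"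
    and q_sym: "q x y = q y x"
begin

sublocale product_sigma_finite "\<lambda>_::nat. M"
  by unfold_locales

lemma q_measurable2 [measurable (raw)]:
  "f \<in> measurable N M \<Longrightarrow> g \<in> measurable N M \<Longrightarrow> (\<lambda>x. q (f x) (g x)) \<in> borel_measurable N"
  using measurable_compose[OF measurable_Pair q_measurable, of f N g] by simp

text \<open>Every vertex has a weight of its own, so that integrating out one vertex
  \<open>y\<close> leaves a density of the same form: the edges at \<open>y\<close> are absorbed
  into the weights of the other vertices.\<close>

definition multi :: "nat \<Rightarrow> (nat \<Rightarrow> 'a \<Rightarrow> ennreal) \<Rightarrow> ennreal" where
  "multi k h = (\<integral>\<^sup>+x. (\<Prod>i\<in>{1..k}. h i (x i)) * (\<Prod>e\<in>vertex_pairs k. q (x (fst e)) (x (snd e)))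
     \<partial>Pi\<^sub>M {1..k} (\<lambda>_. M))"

lemma multi_cong:
  assumes "\<And>i x. i \<in> {1..k} \<Longrightarrow> x \<in> space M \<Longrightarrow> h i x = h' i x"
  shows "multi k h = multi k h'"
  unfolding multi_def using assms
  by (intro nn_integral_cong arg_cong2[where f="(*)"] prod.cong refl) (auto simp: space_PiM PiE_def Pi_iff)

lemma multi_mono:
  assumes "\<And>i x. i \<in> {1..k} \<Longrightarrow> x \<in> space M \<Longrightarrow> h i x \<le> h' i x"
  shows "multi k h \<le> multi k h'"
  unfolding multi_def using assms
  by (intro nn_integral_mono mult_right_mono prod_mono_ennreal) (auto simp: space_PiM PiE_def Pi_iff)

lemma multi_0 [simp]: "multi 0 h = 1"
proof -
  interpret P: prob_space "Pi\<^sub>M {} (\<lambda>_::nat. M)"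
    by (intro prob_space_PiM) (rule prob_space_axioms)
  show ?thesis by (simp add: multi_def P.emeasure_space_1)
qed

lemma multi_integrand_measurable:
  assumes [measurable]: "\<And>i. i \<in> {1..k} \<Longrightarrow> h i \<in> borel_measurable M"
  shows "(\<lambda>x. (\<Prod>i\<in>{1..k}. h i (x i)) * (\<Prod>e\<in>vertex_pairs k. q (x (fst e)) (x (snd e))))
    \<in> borel_measurable (Pi\<^sub>M {1..k} (\<lambda>_. M))"
proof (intro borel_measurable_times_ennreal borel_measurable_prod_ennreal)
  fix i assume i: "i \<in> {1..k}"
  then show "(\<lambda>x. h i (x i)) \<in> borel_measurable (Pi\<^sub>M {1..k} (\<lambda>_. M))"
    by measurable
next
  fix e assume "e \<in> vertex_pairs k"
  then have [measurable]: "fst e \<in> {1..k}" "snd e \<in> {1..k}" by (auto simp: vertex_pairs_def)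
  show "(\<lambda>x. q (x (fst e)) (x (snd e))) \<in> borel_measurable (Pi\<^sub>M {1..k} (\<lambda>_. M))"
    by measurable
qed

lemma multi_Suc:
  assumes h [measurable]: "\<And>i. h i \<in> borel_measurable M"
  shows "multi (Suc k) h = (\<integral>\<^sup>+y. h (Suc k) y * multi k (\<lambda>i x. h i x * q x y) \<partial>M)"
proof -
  let ?F = "\<lambda>k h x. (\<Prod>i\<in>{1..k}. h i (x i)) * (\<Prod>e\<in>vertex_pairs k. q (x (fst e)) (x (snd e)))"
  have ins: "{1..Suc k} = insert (Suc k) {1..k}" by auto
  have "multi (Suc k) h = (\<integral>\<^sup>+x. ?F (Suc k) h x \<partial>Pi\<^sub>M {1..Suc k} (\<lambda>_. M))"
    by (simp add: multi_def)
  also have "\<dots> = (\<integral>\<^sup>+y. \<integral>\<^sup>+x. ?F (Suc k) h (x(Suc k := y)) \<partial>Pi\<^sub>M {1..k} (\<lambda>_. M) \<partial>M)"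
    using multi_integrand_measurable[of "Suc k" h] unfolding ins
    by (subst product_nn_integral_insert_rev) (auto simp flip: ins)
  also have "\<dots> = (\<integral>\<^sup>+y. \<integral>\<^sup>+x. h (Suc k) y * ?F k (\<lambda>i x. h i x * q x y) x \<partial>Pi\<^sub>M {1..k} (\<lambda>_. M) \<partial>M)"
  proof (intro nn_integral_cong)
    fix x y
    have 1: "(\<Prod>i\<in>{1..Suc k}. h i ((x(Suc k := y)) i)) = h (Suc k) y * (\<Prod>i\<in>{1..k}. h i (x i))"
      by (subst ins, subst prod.insert) (auto intro!: arg_cong2[where f="(*)"] prod.cong)
    have 2: "(\<Prod>e\<in>vertex_pairs (Suc k). q ((x(Suc k := y)) (fst e)) ((x(Suc k := y)) (snd e)))
       = (\<Prod>e\<in>vertex_pairs k. q (x (fst e)) (x (snd e))) * (\<Prod>i\<in>{1..k}. q (x i) y)"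
      unfolding prod_vertex_pairs_Suc
      by (intro arg_cong2[where f="(*)"] prod.cong) (auto simp: vertex_pairs_def)
    show "?F (Suc k) h (x(Suc k := y)) = h (Suc k) y * ?F k (\<lambda>i x. h i x * q x y) x"
      unfolding 1 2 by (simp add: prod.distrib mult_ac)
  qed
  also have "\<dots> = (\<integral>\<^sup>+y. h (Suc k) y * multi k (\<lambda>i x. h i x * q x y) \<partial>M)"
    unfolding multi_def
  proof (intro nn_integral_cong nn_integral_cmult)
    fix y assume "y \<in> space M"
    then show "?F k (\<lambda>i x. h i x * q x y) \<in> borel_measurable (Pi\<^sub>M {1..k} (\<lambda>_. M))"
      by (intro multi_integrand_measurable) measurable
  qed
  finally show ?thesis .
qed

text \<open>The weights may depend on a parameter \<open>z\<close>. This lets the densities inside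
  the recursion be integrated once more, and makes sets of points that are defined through such
  densities measurable.\<close>

lemma multi_measurable [measurable (raw)]:
  assumes h [measurable]: "\<And>i. case_prod (h i) \<in> borel_measurable (N \<Otimes>\<^sub>M M)"
  shows "(\<lambda>z. multi k (\<lambda>i. h i z)) \<in> borel_measurable N"
  unfolding multi_def
proof (rule sigma_finite_measure.borel_measurable_nn_integral)
  interpret P: prob_space "Pi\<^sub>M {1..k} (\<lambda>_. M)"
    by (intro prob_space_PiM) (rule prob_space_axioms)
  show "sigma_finite_measure (Pi\<^sub>M {1..k} (\<lambda>_. M))" by unfold_locales
  show "(\<lambda>(z, x). (\<Prod>i\<in>{1..k}. h i z (x i)) * (\<Prod>e\<in>vertex_pairs k. q (x (fst e)) (x (snd e))))
    \<in> borel_measurable (N \<Otimes>\<^sub>M Pi\<^sub>M {1..k} (\<lambda>_. M))"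
    unfolding case_prod_beta'
  proof (intro borel_measurable_times_ennreal borel_measurable_prod_ennreal)
    fix i assume i: "i \<in> {1..k}"
    have "(\<lambda>x. (fst x, snd x i)) \<in> measurable (N \<Otimes>\<^sub>M Pi\<^sub>M {1..k} (\<lambda>_. M)) (N \<Otimes>\<^sub>M M)"
      using i by measurable
    from measurable_compose[OF this h[of i]]
    show "(\<lambda>x. h i (fst x) (snd x i)) \<in> borel_measurable (N \<Otimes>\<^sub>M Pi\<^sub>M {1..k} (\<lambda>_. M))"
      by simp
  next
    fix e assume "e \<in> vertex_pairs k"
    then have [measurable]: "fst e \<in> {1..k}" "snd e \<in> {1..k}" by (auto simp: vertex_pairs_def)
    show "(\<lambda>x. q (snd x (fst e)) (snd x (snd e))) \<in> borel_measurable (N \<Otimes>\<^sub>M Pi\<^sub>M {1..k} (\<lambda>_. M))"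
      by measurable
  qed
qed

text \<open>A term in the expansion of the density with weight \<open>f + g\<close>. As
  \<open>q\<close> is symmetric, only the number of vertices carrying \<open>f\<close> matters, so
  the first \<open>j\<close> vertices may stand for any \<open>j\<close> of them.\<close>

definition mixed :: "nat \<Rightarrow> nat \<Rightarrow> ('a \<Rightarrow> ennreal) \<Rightarrow> ('a \<Rightarrow> ennreal) \<Rightarrow> ennreal" where
  "mixed j l f g = multi (j + l) (\<lambda>i. if i \<le> j then f else g)"

abbreviation Z :: "nat \<Rightarrow> ('a \<Rightarrow> ennreal) \<Rightarrow> ennreal" where
  "Z k f \<equiv> multi k (\<lambda>_. f)"

lemma Z_Suc:
  "f \<in> borel_measurable M \<Longrightarrow> Z (Suc k) f = (\<integral>\<^sup>+y. f y * Z k (\<lambda>x. f x * q x y) \<partial>M)"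
  by (rule multi_Suc)

lemma mixed_0 [simp]: "mixed 0 l f g = Z l g"
  unfolding mixed_def by (simp, rule multi_cong) auto

lemma mixed_0_right [simp]: "mixed j 0 f g = Z j f"
  unfolding mixed_def by (simp, rule multi_cong) auto

lemma mixed_measurable [measurable (raw)]:
  assumes [measurable]: "case_prod f \<in> borel_measurable (N \<Otimes>\<^sub>M M)"
    "case_prod g \<in> borel_measurable (N \<Otimes>\<^sub>M M)"
  shows "(\<lambda>z. mixed j l (f z) (g z)) \<in> borel_measurable N"
proof -
  have "(\<lambda>z. multi (j + l) (\<lambda>i. (if i \<le> j then f else g) z)) \<in> borel_measurable N"
    by (rule multi_measurable) auto
  also have "(\<lambda>z. multi (j + l) (\<lambda>i. (if i \<le> j then f else g) z)) = (\<lambda>z. mixed j l (f z) (g z))"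
    unfolding mixed_def by (intro ext arg_cong2[where f=multi] refl) auto
  finally show ?thesis .
qed

lemma mixed_mono:
  assumes "\<And>x. x \<in> space M \<Longrightarrow> f x \<le> f' x" "\<And>x. x \<in> space M \<Longrightarrow> g x \<le> g' x"
  shows "mixed j l f g \<le> mixed j l f' g'"
  unfolding mixed_def by (rule multi_mono) (auto simp: assms)

lemma mixed_Suc_right:
  assumes [measurable]: "f \<in> borel_measurable M" "g \<in> borel_measurable M"
  shows "mixed j (Suc l) f g = (\<integral>\<^sup>+y. g y * mixed j l (\<lambda>x. f x * q x y) (\<lambda>x. g x * q x y) \<partial>M)"
proof -
  have "mixed j (Suc l) f g = multi (Suc (j + l)) (\<lambda>i. if i \<le> j then f else g)"
    by (simp add: mixed_def)
  also have "\<dots> = (\<integral>\<^sup>+y. g y * multi (j + l) (\<lambda>i x. (if i \<le> j then f else g) x * q x y) \<partial>M)"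
    by (subst multi_Suc) (simp_all split: if_split)
  also have "\<dots> = (\<integral>\<^sup>+y. g y * mixed j l (\<lambda>x. f x * q x y) (\<lambda>x. g x * q x y) \<partial>M)"
    unfolding mixed_def
    by (intro nn_integral_cong arg_cong2[where f="(*)"] refl multi_cong) auto
  finally show ?thesis .
qed

text \<open>The basic recursion removes the last vertex, which carries \<open>g\<close>. To remove
  an \<open>f\<close>-vertex instead, first split off a \<open>g\<close>-vertex \<open>z\<close>,
  use the induction hypothesis, and exchange the two integrals; symmetry of \<open>q\<close> makes
  the factor \<open>q y z\<close> fit both orders.\<close>

lemma mixed_Suc_left:
  assumes "f \<in> borel_measurable M" "g \<in> borel_measurable M"
  shows "mixed (Suc j) l f g = (\<integral>\<^sup>+y. f y * mixed j l (\<lambda>x. f x * q x y) (\<lambda>x. g x * q x y) \<partial>M)"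
  using assms
proof (induction l arbitrary: f g)
  case 0
  then show ?case by (simp add: Z_Suc)
next
  case (Suc l)
  note [measurable] = Suc.prems
  interpret pair_sigma_finite M M ..
  let ?q = "\<lambda>f y x. f x * q x y"
  have "mixed (Suc j) (Suc l) f g = (\<integral>\<^sup>+z. g z * mixed (Suc j) l (?q f z) (?q g z) \<partial>M)"
    by (rule mixed_Suc_right) measurable
  also have "\<dots> = (\<integral>\<^sup>+z. \<integral>\<^sup>+y. g z * f y * q y z * mixed j l (?q (?q f z) y) (?q (?q g z) y) \<partial>M \<partial>M)"
    by (intro nn_integral_cong, subst Suc.IH, (measurable)[2], subst nn_integral_cmult[symmetric])
      (auto simp: mult_ac)
  also have "\<dots> = (\<integral>\<^sup>+y. \<integral>\<^sup>+z. g z * f y * q y z * mixed j l (?q (?q f z) y) (?q (?q g z) y) \<partial>M \<partial>M)"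
    by (rule Fubini') measurable
  also have "\<dots> = (\<integral>\<^sup>+y. f y * mixed j (Suc l) (?q f y) (?q g y) \<partial>M)"
    by (intro nn_integral_cong, subst mixed_Suc_right, (measurable)[2], subst nn_integral_cmult[symmetric])
      (auto simp: mult_ac q_sym[of _ "_"] intro!: nn_integral_cong)
  finally show ?case .
qed

text \<open>A binomial theorem: the vertex split off carries \<open>f\<close> or \<open>g\<close>,
  which raises one of the two indices of \<open>mixed\<close>, and Pascal's rule collects the
  terms.\<close>

lemma Z_add:
  assumes "f \<in> borel_measurable M" "g \<in> borel_measurable M"
  shows "Z k (\<lambda>x. f x + g x) = (\<Sum>j\<le>k. of_nat (k choose j) * mixed j (k - j) f g)"
  using assms
proof (induction k arbitrary: f g)
  case (Suc k)
  note [measurable] = Suc.prems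
  let ?q = "\<lambda>f y x. f x * q x y"
  let ?m = "\<lambda>j l. mixed j l f g"
  have "Z (Suc k) (\<lambda>x. f x + g x) = (\<integral>\<^sup>+y. (f y + g y) * Z k (\<lambda>x. ?q f y x + ?q g y x) \<partial>M)"
    by (subst Z_Suc) (auto simp: distrib_right)
  also have "\<dots> = (\<integral>\<^sup>+y. (\<Sum>j\<le>k. of_nat (k choose j) * (f y * mixed j (k - j) (?q f y) (?q g y)) 
       + of_nat (k choose j) * (g y * mixed j (k - j) (?q f y) (?q g y))) \<partial>M)"
    by (intro nn_integral_cong, subst Suc.IH)
      (auto simp: sum_distrib_left algebra_simps)
  also have "\<dots> = (\<Sum>j\<le>k. of_nat (k choose j) * ?m (Suc j) (k - j) + of_nat (k choose j) * ?m j (Suc (k - j)))"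
    by (simp add: nn_integral_sum nn_integral_add nn_integral_cmult mixed_Suc_left mixed_Suc_right)
  also have "\<dots> = (\<Sum>j\<le>Suc k. of_nat (Suc k choose j) * ?m j (Suc k - j))"
  proof -
    have "(\<Sum>j\<le>Suc k. of_nat (Suc k choose j) * ?m j (Suc k - j))
      = ?m 0 (Suc k) + (\<Sum>j\<le>k. of_nat (k choose j) * ?m (Suc j) (k - j) + of_nat (k choose Suc j) * ?m (Suc j) (k - j))"
      by (subst sum.atMost_Suc_shift) (simp add: distrib_right)
    also have "\<dots> = (\<Sum>j\<le>k. of_nat (k choose j) * ?m (Suc j) (k - j))
       + (?m 0 (Suc k) + (\<Sum>j\<le>k. of_nat (k choose Suc j) * ?m (Suc j) (k - j)))"
      by (simp add: sum.distrib algebra_simps)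
    also have "?m 0 (Suc k) + (\<Sum>j\<le>k. of_nat (k choose Suc j) * ?m (Suc j) (k - j))
       = (\<Sum>j\<le>Suc k. of_nat (k choose j) * ?m j (Suc k - j))"
      by (subst sum.atMost_Suc_shift) simp
    also have "\<dots> = (\<Sum>j\<le>k. of_nat (k choose j) * ?m j (Suc (k - j)))"
      by (auto simp: Suc_diff_le intro!: sum.cong)
    finally show ?thesis by (simp add: sum.distrib)
  qed
  finally show ?case .
qed simp

text \<open>As \<open>q\<close> is at most 1, deleting all edges that meet a \<open>g\<close>-vertex
  can only increase the density.\<close>

lemma mixed_le:
  assumes "f \<in> borel_measurable M" "g \<in> borel_measurable M"
    and q1: "\<And>x y. q x y \<le> 1"
  shows "mixed j l f g \<le> Z j f * (\<integral>\<^sup>+x. g x \<partial>M) ^ l"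
  using assms(1,2)
proof (induction l arbitrary: f g)
  case (Suc l)
  note [measurable] = Suc.prems
  have "mixed j (Suc l) f g = (\<integral>\<^sup>+y. g y * mixed j l (\<lambda>x. f x * q x y) (\<lambda>x. g x * q x y) \<partial>M)"
    by (rule mixed_Suc_right) measurable
  also have "\<dots> \<le> (\<integral>\<^sup>+y. g y * mixed j l f g \<partial>M)"
    by (intro nn_integral_mono mult_left_mono mixed_mono) 
      (use q1 mult_left_mono[OF q1] in auto)
  also have "\<dots> = (\<integral>\<^sup>+y. g y \<partial>M) * mixed j l f g"
    by (rule nn_integral_multc) measurable
  also have "\<dots> \<le> (\<integral>\<^sup>+y. g y \<partial>M) * (Z j f * (\<integral>\<^sup>+x. g x \<partial>M) ^ l)"
    by (intro mult_left_mono Suc.IH) (use Suc.prems in auto)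
  finally show ?case by (simp add: mult_ac)
qed simp

text \<open>The expansion of \<open>Z_add\<close> is bounded termwise, and the binomial theorem sums
  the bounds. Adding \<open>g\<close> thus raises the exponential base by no more than its
  integral.\<close>

lemma Z_add_le:
  assumes [measurable]: "f \<in> borel_measurable M" "g \<in> borel_measurable M"
    and q1: "\<And>x y. q x y \<le> 1"
    and C: "\<And>j. Z j f \<le> C * c ^ j"
  shows "Z k (\<lambda>x. f x + g x) \<le> C * (c + (\<integral>\<^sup>+x. g x \<partial>M)) ^ k"
proof -
  have "Z k (\<lambda>x. f x + g x) = (\<Sum>j\<le>k. of_nat (k choose j) * mixed j (k - j) f g)"
    by (rule Z_add) measurable
  also have "\<dots> \<le> (\<Sum>j\<le>k. of_nat (k choose j) * (C * c ^ j * (\<integral>\<^sup>+x. g x \<partial>M) ^ (k - j)))"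
    by (intro sum_mono mult_left_mono order_trans[OF mixed_le[OF _ _ q1]] mult_right_mono C) auto
  also have "\<dots> = C * (c + (\<integral>\<^sup>+x. g x \<partial>M)) ^ k"
    by (simp add: binomial_ring sum_distrib_left mult_ac)
  finally show ?thesis .
qed

end

text \<open>Absorbs a factor \<open>k\<close>, which will come from a union bound over the vertices,
  into a slightly larger base.\<close>

lemma linear_times_power_le:
  fixes c d :: real
  assumes "0 < c" "c < d"
  shows "real k * c ^ (k - 1) \<le> d ^ k / (d - c)"
proof -
  have "real k * c ^ (k - 1) * (d - c) \<le> d ^ k"
  proof (induction k)
    case (Suc k)
    have "real (Suc k) * c ^ (Suc k - 1) * (d - c) = c * (real k * c ^ (k - 1) * (d - c)) + c ^ k * (d - c)"
      by (cases k) (simp_all add: algebra_simps)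
    also have "\<dots> \<le> c * d ^ k + d ^ k * (d - c)"
      using Suc assms by (intro add_mono mult_left_mono mult_right_mono power_mono) auto
    also have "\<dots> = d ^ Suc k" by (simp add: algebra_simps)
    finally show ?case .
  qed simp
  then show ?thesis using assms by (simp add: field_simps)
qed

section \<open>Exponential growth rates of weighted clique densities\<close>

context sym_kernel begin

text \<open>\<open>subexp b f\<close> says that \<open>limsup (Z k f) powr (1 / k) < b\<close>.\<close>
definition subexp :: "real \<Rightarrow> ('a \<Rightarrow> ennreal) \<Rightarrow> bool" where
  "subexp b f \<longleftrightarrow> (\<exists>c n. 0 < c \<and> c < b \<and> (\<forall>k. Z k f \<le> of_nat n * ennreal c ^ k))"

text \<open>Rounds a real constant up. With natural constants, countably many pairs of a constant
  and a rational base suffice in \<open>exists_clique\<close>.\<close>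

lemma subexpI:
  assumes "0 < c" "c < b" "\<And>k. Z k f \<le> ennreal C * ennreal c ^ k"
  shows "subexp b f"
proof -
  obtain n :: nat where "C \<le> real n" using real_arch_simple by blast
  then have "ennreal C \<le> of_nat n"
    by (metis ennreal_leI ennreal_of_nat_eq_real_of_nat)
  then have "\<And>k. Z k f \<le> of_nat n * ennreal c ^ k"
    using assms(3) by (meson mult_right_mono order_trans zero_le)
  then show ?thesis using assms unfolding subexp_def by blast
qed

text \<open>Otherwise \<open>(b / c) ^ k\<close> would be bounded in \<open>k\<close> for some
  positive \<open>c < b\<close>.\<close>

lemma not_subexp_one:
  assumes "\<And>k. k \<ge> 1 \<Longrightarrow> ennreal b ^ k \<le> Z k (\<lambda>_. 1)"
  shows "\<not> subexp b (\<lambda>_. 1)"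
proof
  assume "subexp b (\<lambda>_. 1)"
  then obtain c n where c: "0 < c" "c < b" and n: "\<And>k. Z k (\<lambda>_. 1) \<le> of_nat n * ennreal c ^ k"
    unfolding subexp_def by blast
  obtain k where k: "real (Suc n) < (b / c) ^ k"
    using real_arch_pow[of "b / c" "real (Suc n)"] c by (auto simp: field_simps)
  then have "k \<ge> 1" by (cases k) auto
  have "ennreal b ^ k \<le> of_nat n * ennreal c ^ k"
    using assms[OF \<open>k \<ge> 1\<close>] n[of k] by simp
  then have "ennreal (b ^ k) \<le> ennreal (real n * c ^ k)"
    using c by (simp add: ennreal_power ennreal_mult flip: ennreal_of_nat_eq_real_of_nat)
  then have "b ^ k \<le> real n * c ^ k"
    using c by (subst (asm) ennreal_le_iff) auto
  moreover have "real (Suc n) * c ^ k < b ^ k"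
    using k c by (simp add: power_divide pos_less_divide_eq)
  moreover have "0 < c ^ k" using c by simp
  ultimately show False by (simp only: of_nat_Suc distrib_right)
qed

text \<open>Since \<open>q\<close> is at most 1, the density is at most the \<open>k\<close>-th
  power of the integral. Read contrapositively, a weight that is not \<open>subexp b\<close> has
  integral at least \<open>b\<close>.\<close>

lemma subexp_if_integral_less:
  assumes [measurable]: "f \<in> borel_measurable M"
    and q1: "\<And>x y. q x y \<le> 1"
    and less: "(\<integral>\<^sup>+x. f x \<partial>M) < ennreal b"
  shows "subexp b f"
proof -
  obtain d where d: "0 \<le> d" "(\<integral>\<^sup>+x. f x \<partial>M) = ennreal d"
    using less by (cases "\<integral>\<^sup>+x. f x \<partial>M") (auto simp: top_unique)
  then have "d < b" using less by (simp add: ennreal_less_iff)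
  \<comment> \<open>Choosing \<open>c\<close> strictly above the integral keeps it positive even if
    the integral is 0.\<close>
  then obtain c where c: "d < c" "c < b" using dense by blast
  show ?thesis
  proof (rule subexpI[of c b f 1])
    fix k
    have "Z k f \<le> (\<integral>\<^sup>+x. f x \<partial>M) ^ k"
      using mixed_le[of f f 0 k] q1 by simp
    also have "\<dots> \<le> ennreal c ^ k"
      unfolding d using c d by (intro power_mono ennreal_leI) auto
    finally show "Z k f \<le> ennreal 1 * ennreal c ^ k" by simp
  qed (use c d in auto)
qed

text \<open>There is room between the base \<open>c\<close> and \<open>b\<close>, and by
  \<open>Z_add_le\<close> a perturbation of small integral uses up only part of it. This openness
  lets the opposite property pass to decreasing limits.\<close>

lemma subexp_add:
  assumes [measurable]: "f \<in> borel_measurable M" 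
    and q1: "\<And>x y. q x y \<le> 1"
    and bad: "subexp b f"
  obtains e where "0 < e"
    "\<And>g. g \<in> borel_measurable M \<Longrightarrow> (\<integral>\<^sup>+x. g x \<partial>M) < ennreal e \<Longrightarrow> subexp b (\<lambda>x. f x + g x)"
proof -
  obtain c n where c: "0 < c" "c < b" and n: "\<And>k. Z k f \<le> of_nat n * ennreal c ^ k"
    using bad unfolding subexp_def by blast
  obtain d where d: "c < d" "d < b" using dense c by blast
  show thesis
  proof
    show "0 < d - c" using d by simp
    fix g assume [measurable]: "g \<in> borel_measurable M" and g: "(\<integral>\<^sup>+x. g x \<partial>M) < ennreal (d - c)"
    show "subexp b (\<lambda>x. f x + g x)"
    proof (rule subexpI)
      fix k
      have "Z k (\<lambda>x. f x + g x) \<le> of_nat n * (ennreal c + (\<integral>\<^sup>+x. g x \<partial>M)) ^ k"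
        by (rule Z_add_le) (use q1 n in auto)
      also have "\<dots> \<le> of_nat n * (ennreal c + ennreal (d - c)) ^ k"
        using g by (intro mult_left_mono power_mono add_left_mono) auto
      also have "ennreal c + ennreal (d - c) = ennreal d"
        using c d by (subst ennreal_plus[symmetric]) auto
      finally show "Z k (\<lambda>x. f x + g x) \<le> ennreal (real n) * ennreal d ^ k"
        by (simp add: ennreal_of_nat_eq_real_of_nat)
    qed (use c d in auto)
  qed
qed

text \<open>A union bound: either no vertex lies in \<open>T\<close>, or one of the \<open>k\<close>
  vertices is some \<open>y\<close> in \<open>T\<close> and the other \<open>k - 1\<close> are
  weighted by their edges to \<open>y\<close>. For \<open>k = 0\<close> the factor
  \<open>of_nat k\<close> removes the truncated \<open>k - 1\<close>.\<close>

lemma Z_remove_le: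
  assumes "f \<in> borel_measurable M" "T \<in> sets M"
  shows "Z k f \<le> Z k (\<lambda>x. f x * indicator (- T) x)
    + of_nat k * (\<integral>\<^sup>+y. f y * indicator T y * Z (k - 1) (\<lambda>x. f x * q x y) \<partial>M)"
  using assms
proof (induction k arbitrary: f)
  case (Suc k)
  note [measurable] = Suc.prems
  interpret pair_sigma_finite M M ..
  let ?q = "\<lambda>f y x. f x * q x y"
  let ?i = "\<lambda>f x. f x * indicator (- T) x :: ennreal"
  have [measurable]: "- T \<inter> space M \<in> sets M" 
    using sets.compl_sets[OF Suc.prems(2)] by (simp add: Diff_eq Int_commute)
  have [measurable]: "(indicator (- T) :: 'a \<Rightarrow> ennreal) \<in> borel_measurable M"
    by (subst borel_measurable_indicator_iff) (simp add: Int_commute)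
  have "Z (Suc k) f = (\<integral>\<^sup>+y. f y * indicator T y * Z k (?q f y) + ?i f y * Z k (?q f y) \<partial>M)"
    by (subst Z_Suc) (auto intro!: nn_integral_cong split: split_indicator)
  then have split: "Z (Suc k) f = (\<integral>\<^sup>+y. f y * indicator T y * Z k (?q f y) \<partial>M) + (\<integral>\<^sup>+y. ?i f y * Z k (?q f y) \<partial>M)"
    by (subst (asm) nn_integral_add) simp_all
  have "(\<integral>\<^sup>+y. ?i f y * Z k (?q f y) \<partial>M)
     \<le> (\<integral>\<^sup>+y. ?i f y * (Z k (?i (?q f y)) + of_nat k * (\<integral>\<^sup>+x. f x * q x y * indicator T x * Z (k - 1) (?q (?q f y) x) \<partial>M)) \<partial>M)"
    by (intro nn_integral_mono mult_left_mono Suc.IH) auto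
  also have "\<dots> = (\<integral>\<^sup>+y. ?i f y * Z k (?i (?q f y)) \<partial>M) 
     + of_nat k * (\<integral>\<^sup>+y. \<integral>\<^sup>+x. ?i f y * f x * q x y * indicator T x * Z (k - 1) (?q (?q f y) x) \<partial>M \<partial>M)"
    (is "_ = _ + of_nat k * ?I")
  proof -
    let ?J = "\<lambda>y. \<integral>\<^sup>+x. f x * q x y * indicator T x * Z (k - 1) (?q (?q f y) x) \<partial>M"
    have "(\<integral>\<^sup>+y. ?i f y * (Z k (?i (?q f y)) + of_nat k * ?J y) \<partial>M)
      = (\<integral>\<^sup>+y. ?i f y * Z k (?i (?q f y)) + of_nat k * (?i f y * ?J y) \<partial>M)"
      by (simp add: distrib_left mult_ac)
    also have "\<dots> = (\<integral>\<^sup>+y. ?i f y * Z k (?i (?q f y)) \<partial>M) + of_nat k * (\<integral>\<^sup>+y. ?i f y * ?J y \<partial>M)"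
      by (subst nn_integral_add) (simp_all add: nn_integral_cmult)
    also have "(\<integral>\<^sup>+y. ?i f y * ?J y \<partial>M) = ?I"
      by (intro nn_integral_cong, subst nn_integral_cmult[symmetric]) (simp_all add: mult_ac)
    finally show ?thesis .
  qed
  also have "(\<integral>\<^sup>+y. ?i f y * Z k (?i (?q f y)) \<partial>M) = Z (Suc k) (?i f)"
    by (subst Z_Suc) (auto simp: mult_ac)
  finally have 1: "(\<integral>\<^sup>+y. ?i f y * Z k (?q f y) \<partial>M) \<le> Z (Suc k) (?i f) + of_nat k * ?I" .
  \<comment> \<open>In \<open>?I\<close> the distinguished vertex of \<open>T\<close> is
    \<open>x\<close>, and \<open>y\<close> lies outside \<open>T\<close>. Exchanging the integrals
    and forgetting that condition on \<open>y\<close> turns \<open>y\<close> into one of the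
    ordinary vertices around \<open>x\<close>.\<close>
  have 2: "of_nat k * ?I \<le> of_nat k * (\<integral>\<^sup>+y. f y * indicator T y * Z k (?q f y) \<partial>M)"
  proof (cases k)
    case (Suc m)
    have "?I = (\<integral>\<^sup>+x. \<integral>\<^sup>+y. ?i f y * f x * q x y * indicator T x * Z m (?q (?q f y) x) \<partial>M \<partial>M)"
      unfolding Suc by (subst Fubini') simp_all
    also have "\<dots> \<le> (\<integral>\<^sup>+x. f x * indicator T x * Z k (?q f x) \<partial>M)"
    proof (rule nn_integral_mono)
      fix x assume [measurable]: "x \<in> space M"
      have "(\<integral>\<^sup>+y. ?i f y * f x * q x y * indicator T x * Z m (?q (?q f y) x) \<partial>M)
        \<le> (\<integral>\<^sup>+y. f x * indicator T x * (?q f x y * Z m (?q (?q f x) y)) \<partial>M)"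
        by (intro nn_integral_mono) (auto simp: mult_ac q_sym[of x] split: split_indicator)
      also have "\<dots> = f x * indicator T x * Z k (?q f x)"
        unfolding Suc by (subst Z_Suc, measurable, subst nn_integral_cmult) simp_all
      finally show "(\<integral>\<^sup>+y. ?i f y * f x * q x y * indicator T x * Z m (?q (?q f y) x) \<partial>M) \<le> \<dots>" .
    qed
    finally show ?thesis by (intro mult_left_mono) auto
  qed simp
  have "Z (Suc k) f \<le> (\<integral>\<^sup>+y. f y * indicator T y * Z k (?q f y) \<partial>M) + (Z (Suc k) (?i f) +
     of_nat k * (\<integral>\<^sup>+y. f y * indicator T y * Z k (?q f y) \<partial>M))"
    unfolding split by (intro add_left_mono order_trans[OF 1] 2)
  then show ?case by (simp add: algebra_simps)
qed simp

text \<open>By \<open>Z_remove_le\<close>, putting \<open>T\<close> back costs at most a multiple of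
  \<open>k * c ^ (k - 1)\<close>, which is still exponential with a base below
  \<open>b\<close>.\<close>

lemma subexp_remove:
  assumes [measurable]: "f \<in> borel_measurable M" "T \<in> sets M"
    and f1: "\<And>x. f x \<le> 1"
    and c: "0 < c" "c < b"
    and T: "\<And>y k. y \<in> T \<Longrightarrow> Z k (\<lambda>x. f x * q x y) \<le> of_nat n * ennreal c ^ k"
    and bad: "subexp b (\<lambda>x. f x * indicator (- T) x)"
  shows "subexp b f"
proof -
  obtain c' n' where c': "0 < c'" "c' < b"
    and n': "\<And>k. Z k (\<lambda>x. f x * indicator (- T) x) \<le> of_nat n' * ennreal c' ^ k"
    using bad unfolding subexp_def by blast
  obtain d where d: "max c c' < d" "d < b" using dense[of "max c c'" b] c c' by auto
  show ?thesis
  proof (rule subexpI)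
    fix k
    have "(\<integral>\<^sup>+y. f y * indicator T y * Z (k - 1) (\<lambda>x. f x * q x y) \<partial>M) 
      \<le> (\<integral>\<^sup>+y. 1 * (of_nat n * ennreal c ^ (k - 1)) \<partial>M)"
    proof (rule nn_integral_mono)
      fix y
      show "f y * indicator T y * Z (k - 1) (\<lambda>x. f x * q x y) \<le> 1 * (of_nat n * ennreal c ^ (k - 1))"
        using mult_mono[OF f1[of y] T[of y "k - 1"]] by (cases "y \<in> T") auto
    qed
    also have "\<dots> = of_nat n * ennreal c ^ (k - 1)"
      by (simp add: emeasure_space_1)
    finally have "Z k f \<le> of_nat n' * ennreal c' ^ k + of_nat k * (of_nat n * ennreal c ^ (k - 1))"
      using Z_remove_le[of f T k] n'[of k] by (meson add_mono assms(1) assms(2) mult_left_mono order_trans zero_le)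
    also have "\<dots> = ennreal (real n' * c' ^ k + real n * (real k * c ^ (k - 1)))"
      using c c' by (simp add: ennreal_power ennreal_mult ennreal_of_nat_eq_real_of_nat mult_ac)
    also have "\<dots> \<le> ennreal (real n' * d ^ k + real n * (d ^ k / (d - c)))"
      using c c' d linear_times_power_le[of c d k]
      by (intro ennreal_leI add_mono mult_left_mono power_mono) auto
    also have "\<dots> = ennreal ((real n' + real n / (d - c)) * d ^ k)"
      by (simp add: algebra_simps)
    also have "\<dots> = ennreal (real n' + real n / (d - c)) * ennreal d ^ k"
      using c c' d by (simp add: ennreal_power ennreal_mult)
    finally show "Z k f \<le> ennreal (real n' + real n / (d - c)) * ennreal d ^ k" .
  qed (use c c' d in auto)
qed

text \<open>A greedy descent: each weight \<open>F (Suc n)\<close> lies below \<open>F n\<close> and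
  has nearly the least integral possible there. The pointwise limit is not \<open>subexp b\<close>
  because that property is open, and any competitor below the limit is below every
  \<open>F n\<close>.\<close>

lemma exists_minimal_not_subexp:
  assumes q1: "\<And>x y. q x y \<le> 1"
    and one: "\<not> subexp b (\<lambda>_. 1)"
  obtains f where "f \<in> borel_measurable M" "\<And>x. f x \<le> 1" "\<not> subexp b f"
    "\<And>g. g \<in> borel_measurable M \<Longrightarrow> (\<And>x. g x \<le> f x) \<Longrightarrow> \<not> subexp b g \<Longrightarrow>
       (\<integral>\<^sup>+x. f x \<partial>M) \<le> (\<integral>\<^sup>+x. g x \<partial>M)"
proof -
  define ok where "ok f \<longleftrightarrow> f \<in> borel_measurable M \<and> (\<forall>x. f x \<le> 1) \<and> \<not> subexp b f" for f
  \<comment> \<open>The least integral that can be approached by admissible weights below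
    \<open>f\<close>.\<close>
  define m where "m f = (INF g\<in>{g. ok g \<and> g \<le> f}. \<integral>\<^sup>+x. g x \<partial>M)" for f
  have step: "\<exists>g. ok g \<and> g \<le> f \<and> (\<integral>\<^sup>+x. g x \<partial>M) \<le> m f + ennreal (1 / Suc n)" if "ok f" for f n
  proof -
    have "m f \<le> (\<integral>\<^sup>+x. f x \<partial>M)" unfolding m_def using that by (intro INF_lower) auto
    also have "\<dots> \<le> (\<integral>\<^sup>+x. 1 \<partial>M)" using that by (intro nn_integral_mono) (auto simp: ok_def)
    finally have "m f \<le> 1" by (simp add: emeasure_space_1)
    then have "m f < m f + ennreal (1 / Suc n)"
      by (cases "m f") (auto simp: ennreal_plus[symmetric] top_unique ennreal_less_iff simp del: ennreal_plus)
    then obtain g where "ok g" "g \<le> f" "(\<integral>\<^sup>+x. g x \<partial>M) < m f + ennreal (1 / Suc n)"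
      unfolding m_def by (subst (asm) (1) INF_less_iff) auto
    then show ?thesis by (intro exI[of _ g]) auto
  qed
  have "\<exists>F. \<forall>n. ok (F n) \<and> (F (Suc n) \<le> F n \<and> (\<integral>\<^sup>+x. F (Suc n) x \<partial>M) \<le> m (F n) + ennreal (1 / Suc n))"
    using step one by (intro dependent_nat_choice) (auto simp: ok_def intro!: exI[of _ "\<lambda>_. 1"])
  then obtain F where F: "\<And>n. ok (F n)" "\<And>n. F (Suc n) \<le> F n"
    "\<And>n. (\<integral>\<^sup>+x. F (Suc n) x \<partial>M) \<le> m (F n) + ennreal (1 / Suc n)"
    by blast
  have dec: "decseq F" using F(2) by (rule decseq_SucI)
  have [measurable]: "F n \<in> borel_measurable M" for n using F(1) by (auto simp: ok_def)
  define f where "f x = (INF n. F n x)" for x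
  have [measurable]: "f \<in> borel_measurable M" unfolding f_def by measurable
  have f_le: "f x \<le> F n x" for x n unfolding f_def by (rule INF_lower) auto
  have F1: "F n x \<le> 1" for n x using F(1) by (auto simp: ok_def)
  have int_F: "(\<integral>\<^sup>+x. F n x \<partial>M) \<le> 1" for n
    using nn_integral_mono[of M "F n" "\<lambda>_. 1"] F1 by (simp add: emeasure_space_1)
  have int_f: "(\<integral>\<^sup>+x. f x \<partial>M) = (INF n. \<integral>\<^sup>+x. F n x \<partial>M)"
    unfolding f_def using int_F
    by (intro nn_integral_monotone_convergence_INF_decseq[where i = 0] dec)
      (use le_less_trans[OF int_F] in auto)
  have "(\<integral>\<^sup>+x. f x \<partial>M) \<le> 1" using int_F[of 0] nn_integral_mono[of M f "F 0"] f_le order_trans by blast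
  then have fin: "(\<integral>\<^sup>+x. f x \<partial>M) \<noteq> \<infinity>" by (auto simp: top_unique)
  show thesis
  proof
    show "f x \<le> 1" for x using f_le F1 order_trans by blast
    show "\<not> subexp b f"
    proof
      assume "subexp b f"
      \<comment> \<open>Openness at \<open>f\<close> contradicts the choice of \<open>F n\<close>
        for large \<open>n\<close>, since \<open>F n - f\<close> has arbitrarily small integral by
        monotone convergence.\<close>
      then obtain e where e: "0 < e"
        "\<And>g. g \<in> borel_measurable M \<Longrightarrow> (\<integral>\<^sup>+x. g x \<partial>M) < ennreal e \<Longrightarrow> subexp b (\<lambda>x. f x + g x)"
        using subexp_add[of f b] q1 by auto
      have "(\<integral>\<^sup>+x. f x \<partial>M) < (\<integral>\<^sup>+x. f x \<partial>M) + ennreal e"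
        using fin e(1) by (cases "\<integral>\<^sup>+x. f x \<partial>M")
          (auto simp: ennreal_plus[symmetric] ennreal_less_iff simp del: ennreal_plus)
      then obtain n where n: "(\<integral>\<^sup>+x. F n x \<partial>M) < (\<integral>\<^sup>+x. f x \<partial>M) + ennreal e"
        unfolding int_f by (subst (asm) (1) INF_less_iff) auto
      have "(\<integral>\<^sup>+x. F n x - f x \<partial>M) = (\<integral>\<^sup>+x. F n x \<partial>M) - (\<integral>\<^sup>+x. f x \<partial>M)"
        using fin f_le by (intro nn_integral_diff) auto
      also have "\<dots> < ennreal e"
        using n fin nn_integral_mono[of M f "F n"] f_le
        by (subst minus_less_iff_ennreal) (auto simp: add.commute less_top[symmetric])
      finally have "subexp b (\<lambda>x. f x + (F n x - f x))" by (intro e) measurable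
      then show False using F(1)[of n] by (simp add: add_diff_inverse_ennreal f_le ok_def)
    qed
    fix g assume g: "g \<in> borel_measurable M" "\<And>x. g x \<le> f x" "\<not> subexp b g"
    have eps: "(\<integral>\<^sup>+x. f x \<partial>M) \<le> (\<integral>\<^sup>+x. g x \<partial>M) + ennreal e" if "e > 0" for e
    proof -
      obtain n where n: "1 / Suc n < e" using \<open>e > 0\<close> nat_approx_posE by blast
      have "ok g" using g order_trans[OF g(2) order_trans[OF f_le F1]] unfolding ok_def by blast
      moreover have "g \<le> F n" using order_trans[OF g(2) f_le] by (auto simp: le_fun_def)
      ultimately have "m (F n) \<le> (\<integral>\<^sup>+x. g x \<partial>M)" unfolding m_def by (intro INF_lower) auto
      have "(\<integral>\<^sup>+x. f x \<partial>M) \<le> (\<integral>\<^sup>+x. F (Suc n) x \<partial>M)" using f_le by (intro nn_integral_mono)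
      also have "\<dots> \<le> m (F n) + ennreal (1 / Suc n)" by (rule F)
      also have "\<dots> \<le> (\<integral>\<^sup>+x. g x \<partial>M) + ennreal e"
        using n \<open>m (F n) \<le> _\<close> by (intro add_mono ennreal_leI) auto
      finally show ?thesis .
    qed
    show "(\<integral>\<^sup>+x. f x \<partial>M) \<le> (\<integral>\<^sup>+x. g x \<partial>M)"
      by (rule ennreal_le_epsilon) (rule eps)
  qed measurable
qed

text \<open>
  For a weight \<open>f\<close> of minimal integral among those that are not \<open>subexp b\<close>, almost every \<open>y\<close>
  with \<open>f y \<noteq> 0\<close> leaves \<open>\<lambda>x. f x * q x y\<close> not \<open>subexp b\<close>, so minimality forces \<open>q x y = 1\<close>
  almost everywhere on the support of \<open>f\<close>.
\<close>
theorem exists_clique: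
  assumes q1: "\<And>x y. q x y \<le> 1"
    and Z: "\<And>k. k \<ge> 1 \<Longrightarrow> ennreal b ^ k \<le> Z k (\<lambda>_. 1)"
  obtains B where "B \<in> sets M" "ennreal b \<le> emeasure M B"
    "AE z in M \<Otimes>\<^sub>M M. fst z \<in> B \<longrightarrow> snd z \<in> B \<longrightarrow> q (fst z) (snd z) = 1"
proof -
  interpret pair_sigma_finite M M ..
  obtain f where [measurable]: "f \<in> borel_measurable M" and f1: "\<And>x. f x \<le> 1" and nf: "\<not> subexp b f"
    and min: "\<And>g. g \<in> borel_measurable M \<Longrightarrow> (\<And>x. g x \<le> f x) \<Longrightarrow> \<not> subexp b g \<Longrightarrow>
       (\<integral>\<^sup>+x. f x \<partial>M) \<le> (\<integral>\<^sup>+x. g x \<partial>M)"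
    using exists_minimal_not_subexp[OF q1 not_subexp_one[OF Z]] by blast
  define B where "B = {x \<in> space M. f x \<noteq> 0}"
  have [measurable]: "B \<in> sets M" unfolding B_def by measurable
  have "(\<integral>\<^sup>+x. f x \<partial>M) \<le> 1"
    using nn_integral_mono[of M f "\<lambda>_. 1"] f1 by (simp add: emeasure_space_1)
  then have fin: "(\<integral>\<^sup>+x. f x \<partial>M) \<noteq> \<infinity>" by (auto simp: top_unique)
  have zero_if_le: "AE x in M. f x - g x = 0"
    if [measurable]: "g \<in> borel_measurable M" and g: "\<And>x. g x \<le> f x" "\<not> subexp b g" for g
  proof -
    have "(\<integral>\<^sup>+x. f x - g x \<partial>M) = (\<integral>\<^sup>+x. f x \<partial>M) - (\<integral>\<^sup>+x. g x \<partial>M)"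
      using fin g(1) nn_integral_mono[of M g f] by (intro nn_integral_diff) (auto simp: top_unique)
    also have "\<dots> = 0" using min[OF that] fin by (subst diff_eq_0_iff_ennreal) (simp_all add: less_top[symmetric])
    finally show ?thesis by (subst (asm) nn_integral_0_iff_AE) measurable
  qed
  \<comment> \<open>For positive rational \<open>r < b\<close> and natural \<open>n\<close>, these
    countably many sets cover all \<open>y\<close> for which \<open>\<lambda>x. f x * q x y\<close>
    is \<open>subexp b\<close>. Hence their null sets can be united.\<close>
  define T where "T r n = {y \<in> space M. \<forall>k. Z k (\<lambda>x. f x * q x y) \<le> of_nat n * ennreal r ^ k}" for r n
  have "AE y in M. y \<in> T (of_rat r) n \<longrightarrow> f y = 0" if r: "0 < real_of_rat r" "real_of_rat r < b" for r n
  proof -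
    have [measurable]: "T (of_rat r) n \<in> sets M" unfolding T_def by measurable
    have "- T (of_rat r) n \<inter> space M \<in> sets M" 
      using sets.compl_sets[of "T (of_rat r) n"] by (simp add: Diff_eq Int_commute)
    then have [measurable]: "(indicator (- T (of_rat r) n) :: 'a \<Rightarrow> ennreal) \<in> borel_measurable M"
      by (subst borel_measurable_indicator_iff) (simp add: Int_commute)
    \<comment> \<open>Otherwise \<open>subexp_remove\<close> would make \<open>f\<close> itself
      \<open>subexp b\<close>. Minimality then shows that deleting the set changes \<open>f\<close>
      only on a null set.\<close>
    have "\<not> subexp b (\<lambda>x. f x * indicator (- T (of_rat r) n) x)"
    proof
      assume *: "subexp b (\<lambda>x. f x * indicator (- T (of_rat r) n) x)"
      have "subexp b f"
        by (rule subexp_remove[OF _ _ f1 r _ *, where n = n]) (simp_all add: T_def)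
      then show False using nf by simp
    qed
    then have "AE x in M. f x - f x * indicator (- T (of_rat r) n) x = 0"
      by (intro zero_if_le) (auto split: split_indicator)
    then show ?thesis by eventually_elim (auto split: split_indicator_asm)
  qed
  then have "AE y in M. \<forall>r n. 0 < real_of_rat r \<longrightarrow> real_of_rat r < b \<longrightarrow> y \<in> T (of_rat r) n \<longrightarrow> f y = 0"
    unfolding AE_all_countable by auto
  then have "AE y in M. y \<in> B \<longrightarrow> (AE x in M. x \<in> B \<longrightarrow> q x y = 1)"
  proof (eventually_elim, intro impI)
    fix y assume y: "\<forall>r n. 0 < real_of_rat r \<longrightarrow> real_of_rat r < b \<longrightarrow> y \<in> T (of_rat r) n \<longrightarrow> f y = 0"
      and yB: "y \<in> B"
    then have [measurable]: "y \<in> space M" by (auto simp: B_def)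
    have "\<not> subexp b (\<lambda>x. f x * q x y)"
    proof
      assume "subexp b (\<lambda>x. f x * q x y)"
      then obtain c n where c: "0 < c" "c < b" and n: "\<And>k. Z k (\<lambda>x. f x * q x y) \<le> of_nat n * ennreal c ^ k"
        unfolding subexp_def by blast
      obtain r where r: "c < of_rat r" "of_rat r < b" using c(2) of_rat_dense by blast
      have "ennreal c ^ k \<le> ennreal (of_rat r) ^ k" for k
        using r c by (intro power_mono ennreal_leI) auto
      from order_trans[OF n mult_left_mono[OF this]] have "y \<in> T (of_rat r) n"
        unfolding T_def using \<open>y \<in> space M\<close> by simp
      moreover have "0 < real_of_rat r" using r c by linarith
      ultimately show False using y yB r by (auto simp: B_def)
    qed
    moreover have fq: "f x * q x y \<le> f x" for x using mult_left_mono[OF q1] by fastforce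
    ultimately have "AE x in M. f x - f x * q x y = 0" by (intro zero_if_le) auto
    then show "AE x in M. x \<in> B \<longrightarrow> q x y = 1"
    proof eventually_elim
      fix x assume *: "f x - f x * q x y = 0"
      \<comment> \<open>Subtraction is truncated, so a zero difference only says
        \<open>f x \<le> f x * q x y\<close>. The converse inequality is \<open>fq\<close>, and the
        finite, nonzero factor \<open>f x\<close> then cancels on \<open>B\<close>.\<close>
      have "f x \<noteq> \<top>" using f1[of x] by (auto simp: top_unique)
      then have "f x \<le> f x * q x y" using * by (auto simp: diff_eq_0_iff_ennreal)
      then have "f x * q x y = f x * 1" using fq[of x] by auto
      then show "x \<in> B \<longrightarrow> q x y = 1"
        using \<open>f x \<noteq> \<top>\<close> by (subst (asm) ennreal_mult_cancel_left) (auto simp: B_def)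
    qed
  qed
  then have "AE y in M. AE x in M. y \<in> B \<longrightarrow> x \<in> B \<longrightarrow> q y x = 1"
    by eventually_elim (auto simp: q_sym)
  then have "AE z in M \<Otimes>\<^sub>M M. fst z \<in> B \<longrightarrow> snd z \<in> B \<longrightarrow> q (fst z) (snd z) = 1"
    by (intro AE_pair_measure) auto
  moreover have "ennreal b \<le> emeasure M B"
  proof -
    have "ennreal b \<le> (\<integral>\<^sup>+x. f x \<partial>M)"
      using subexp_if_integral_less[of f b] q1 nf by force
    also have "\<dots> \<le> (\<integral>\<^sup>+x. indicator B x \<partial>M)"
      using f1 by (intro nn_integral_mono) (auto simp: B_def split: split_indicator)
    finally show ?thesis by simp
  qed
  ultimately show thesis using that \<open>B \<in> sets M\<close> by blast
qed

end

section \<open>Kernels that are constant on two diagonal blocks\<close>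

text \<open>The two moments make the integral of the squared deviation from \<open>m\<close> over
  \<open>S\<close> vanish, so the deviation is 0 almost everywhere.\<close>

lemma AE_eq_if_moments_eq:
  fixes f :: "'a \<Rightarrow> ennreal"
  assumes [measurable]: "f \<in> borel_measurable M" "S \<in> sets M"
    and S: "emeasure M S < \<infinity>" and m: "m < \<infinity>"
    and 1: "(\<integral>\<^sup>+x. indicator S x * f x \<partial>M) = m * emeasure M S"
    and 2: "(\<integral>\<^sup>+x. indicator S x * f x ^ 2 \<partial>M) = m ^ 2 * emeasure M S"
  shows "AE x in M. x \<in> S \<longrightarrow> f x = m"
proof -
  obtain r where r: "0 \<le> r" "m = ennreal r" using m by (cases m) auto
  define h where "h x = indicator S x * ennreal ((enn2real (f x) - r)\<^sup>2)" for x
  have [measurable]: "h \<in> borel_measurable M" unfolding h_def by measurable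
  have fin: "m ^ 2 * emeasure M S < \<infinity>" using S m by (simp add: ennreal_mult_less_top power2_eq_square)
  then have "(\<integral>\<^sup>+x. indicator S x * f x ^ 2 \<partial>M) \<noteq> \<infinity>" unfolding 2 by auto
  then have "AE x in M. indicator S x * f x ^ 2 \<noteq> \<infinity>" by (intro nn_integral_noteq_infinite) auto
  then have ffin: "AE x in M. x \<in> S \<longrightarrow> f x \<noteq> \<infinity>"
    by eventually_elim (auto simp: power2_eq_square ennreal_mult_eq_top_iff split: split_indicator_asm)
  \<comment> \<open>The expansion of the square with the mixed term moved to the left, which avoids
    subtraction of extended reals.\<close>
  have "(\<integral>\<^sup>+x. h x + 2 * m * (indicator S x * f x) \<partial>M) = (\<integral>\<^sup>+x. indicator S x * f x ^ 2 + m ^ 2 * indicator S x \<partial>M)"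
  proof (rule nn_integral_cong_AE, use ffin in eventually_elim, cases)
    fix x assume "x \<in> S \<longrightarrow> f x \<noteq> \<infinity>" "x \<in> S"
    then obtain y where y: "0 \<le> y" "f x = ennreal y" by (cases "f x") auto
    have "h x + 2 * m * (indicator S x * f x) = ennreal ((y - r)\<^sup>2) + ennreal (2 * r * y)"
      using \<open>x \<in> S\<close> y r by (simp add: h_def ennreal_mult)
    also have "\<dots> = ennreal (y\<^sup>2 + r\<^sup>2)"
    proof -
      have "y\<^sup>2 + r\<^sup>2 = (y - r)\<^sup>2 + 2 * r * y" by (simp add: power2_eq_square algebra_simps)
      then show ?thesis using y r by (simp only: ennreal_plus mult_nonneg_nonneg zero_le_power2 zero_le_numeral)
    qed
    also have "\<dots> = indicator S x * f x ^ 2 + m ^ 2 * indicator S x"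
      using \<open>x \<in> S\<close> y r by (simp add: ennreal_power)
    finally show "h x + 2 * m * (indicator S x * f x) = indicator S x * f x ^ 2 + m ^ 2 * indicator S x" .
  qed (simp add: h_def)
  then have "(\<integral>\<^sup>+x. h x \<partial>M) + 2 * m * (m * emeasure M S) = m ^ 2 * emeasure M S + m ^ 2 * emeasure M S"
    by (simp add: nn_integral_add nn_integral_cmult 1 2)
  also have "\<dots> = 0 + 2 * m * (m * emeasure M S)" by (simp add: power2_eq_square mult_ac flip: mult_2)
  finally have "2 * m * (m * emeasure M S) + (\<integral>\<^sup>+x. h x \<partial>M) = 2 * m * (m * emeasure M S) + 0"
    by (simp add: add.commute)
  then have "(\<integral>\<^sup>+x. h x \<partial>M) = 0"
    using fin by (subst (asm) ennreal_add_left_cancel) (auto simp: power2_eq_square ennreal_mult_eq_top_iff ennreal_mult_less_top)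
  then have "AE x in M. h x = 0" by (subst (asm) nn_integral_0_iff_AE) auto
  with ffin show ?thesis
  proof eventually_elim
    fix x assume *: "x \<in> S \<longrightarrow> f x \<noteq> \<infinity>" "h x = 0"
    show "x \<in> S \<longrightarrow> f x = m"
    proof
      assume "x \<in> S"
      then have "enn2real (f x) = r" using *(2) by (simp add: h_def)
      then show "f x = m" using * \<open>x \<in> S\<close> r by (metis ennreal_enn2real infinity_ennreal_def less_top)
    qed
  qed
qed

lemma Suc_choose_two: "Suc k choose 2 = k + (k choose 2)"
  by (simp add: numeral_2_eq_2)

lemma zero_choose_two [simp]: "0 choose 2 = (0::nat)"
  by (simp add: numeral_2_eq_2)

context sym_kernel begin

lemma Z_block:
  assumes "f \<in> borel_measurable M" "\<And>x. x \<notin> A \<Longrightarrow> f x = 0"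
    and q: "\<And>x y. x \<in> A \<Longrightarrow> y \<in> A \<Longrightarrow> q x y = t"
  shows "Z k f = t ^ (k choose 2) * (\<integral>\<^sup>+x. f x \<partial>M) ^ k"
  using assms(1,2)
proof (induction k arbitrary: f)
  case (Suc k)
  note [measurable] = Suc.prems(1)
  have "Z (Suc k) f = (\<integral>\<^sup>+y. f y * Z k (\<lambda>x. f x * q x y) \<partial>M)"
    by (rule Z_Suc) measurable
  also have "\<dots> = (\<integral>\<^sup>+y. f y * (t ^ (k choose 2) * (t * (\<integral>\<^sup>+x. f x \<partial>M)) ^ k) \<partial>M)"
  proof (rule nn_integral_cong)
    fix y
    show "f y * Z k (\<lambda>x. f x * q x y) = f y * (t ^ (k choose 2) * (t * (\<integral>\<^sup>+x. f x \<partial>M)) ^ k)"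
    proof (cases "y \<in> A")
      case True
      then have "(\<lambda>x. f x * q x y) = (\<lambda>x. t * f x)"
        using q Suc.prems(2) by (metis mult.commute mult_zero_left)
      then show ?thesis using Suc.prems by (simp add: Suc.IH nn_integral_cmult)
    qed (simp add: Suc.prems)
  qed
  also have "\<dots> = t ^ (Suc k choose 2) * (\<integral>\<^sup>+x. f x \<partial>M) ^ Suc k"
    by (simp add: nn_integral_multc Suc_choose_two power_add power_mult_distrib mult_ac)
  finally show ?case .
qed simp

text \<open>Of the edges, \<open>j choose 2\<close> lie inside \<open>A\<close>,
  \<open>l choose 2\<close> inside \<open>B\<close>, and \<open>j * l\<close> run across.\<close>

lemma mixed_block:
  assumes "f \<in> borel_measurable M" "\<And>x. x \<notin> A \<Longrightarrow> f x = 0"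
    and "g \<in> borel_measurable M" "\<And>x. x \<notin> B \<Longrightarrow> g x = 0"
    and qA: "\<And>x y. x \<in> A \<Longrightarrow> y \<in> A \<Longrightarrow> q x y = t"
    and qB: "\<And>x y. x \<in> B \<Longrightarrow> y \<in> B \<Longrightarrow> q x y = s"
    and qAB: "\<And>x y. x \<in> A \<Longrightarrow> y \<in> B \<Longrightarrow> q x y = \<kappa>"
  shows "mixed j l f g = t ^ (j choose 2) * s ^ (l choose 2) * \<kappa> ^ (j * l) *
    (\<integral>\<^sup>+x. f x \<partial>M) ^ j * (\<integral>\<^sup>+x. g x \<partial>M) ^ l"
  using assms(1-4)
proof (induction j arbitrary: f g)
  case 0
  then show ?case using Z_block[of g B s l] qB by simp
next
  case (Suc j)
  note [measurable] = Suc.prems(1,3)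
  let ?I = "\<lambda>f. \<integral>\<^sup>+x. f x \<partial>M"
  have "mixed (Suc j) l f g = (\<integral>\<^sup>+y. f y * mixed j l (\<lambda>x. f x * q x y) (\<lambda>x. g x * q x y) \<partial>M)"
    by (rule mixed_Suc_left) measurable
  also have "\<dots> = (\<integral>\<^sup>+y. f y * (t ^ (j choose 2) * s ^ (l choose 2) * \<kappa> ^ (j * l) * (t * ?I f) ^ j * (\<kappa> * ?I g) ^ l) \<partial>M)"
  proof (rule nn_integral_cong)
    fix y
    show "f y * mixed j l (\<lambda>x. f x * q x y) (\<lambda>x. g x * q x y) = 
      f y * (t ^ (j choose 2) * s ^ (l choose 2) * \<kappa> ^ (j * l) * (t * ?I f) ^ j * (\<kappa> * ?I g) ^ l)"
    proof (cases "y \<in> A")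
      case True
      have 1: "(\<lambda>x. f x * q x y) = (\<lambda>x. t * f x)"
        using qA True Suc.prems(2) by (metis mult.commute mult_zero_left)
      have 2: "(\<lambda>x. g x * q x y) = (\<lambda>x. \<kappa> * g x)"
        using qAB True q_sym Suc.prems(4) by (metis mult.commute mult_zero_left)
      show ?thesis using Suc.prems unfolding 1 2 by (simp add: Suc.IH nn_integral_cmult)
    qed (simp add: Suc.prems)
  qed
  also have "\<dots> = t ^ (Suc j choose 2) * s ^ (l choose 2) * \<kappa> ^ (Suc j * l) * ?I f ^ Suc j * ?I g ^ l"
    by (simp add: nn_integral_multc Suc_choose_two power_add power_mult_distrib mult_ac)
  finally show ?case .
qed

end

text \<open>The clique density of a kernel with value \<open>t\<close> on a part of measure
  \<open>a\<close>, \<open>s\<close> on a part of measure \<open>b\<close>, and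
  \<open>\<kappa>\<close> across; \<open>j\<close> counts the vertices falling into the first
  part.\<close>

definition block_sum :: "ennreal \<Rightarrow> ennreal \<Rightarrow> ennreal \<Rightarrow> ennreal \<Rightarrow> ennreal \<Rightarrow> nat \<Rightarrow> ennreal" where
  "block_sum a b t s \<kappa> k = (\<Sum>j\<le>k. of_nat (k choose j) *
     (t ^ (j choose 2) * s ^ ((k - j) choose 2) * \<kappa> ^ (j * (k - j)) * a ^ j * b ^ (k - j)))"

locale block_kernel = sym_kernel M q for M :: "'a measure" and q +
  fixes A B :: "'a set" and t s :: ennreal
  assumes A_sets [measurable]: "A \<in> sets M" and B_sets [measurable]: "B \<in> sets M"
    and disjoint: "A \<inter> B = {}" and cover: "A \<union> B = space M"
    and q_A: "\<And>x y. x \<in> A \<Longrightarrow> y \<in> A \<Longrightarrow> q x y = t"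
    and q_B: "\<And>x y. x \<in> B \<Longrightarrow> y \<in> B \<Longrightarrow> q x y = s"
begin

section \<open>Degrees and codegrees across the two blocks\<close>

definition deg_B :: "'a \<Rightarrow> ennreal" where
  "deg_B x = (\<integral>\<^sup>+y. indicator B y * q y x \<partial>M)"

definition deg_A :: "'a \<Rightarrow> ennreal" where
  "deg_A y = (\<integral>\<^sup>+x. indicator A x * q x y \<partial>M)"

definition codeg :: "'a \<Rightarrow> 'a \<Rightarrow> ennreal" where
  "codeg x x' = (\<integral>\<^sup>+y. indicator B y * q y x * q y x' \<partial>M)"

lemma deg_B_measurable [measurable]: "deg_B \<in> borel_measurable M"
  unfolding deg_B_def by measurable

lemma deg_A_measurable [measurable]: "deg_A \<in> borel_measurable M"
  unfolding deg_A_def by measurable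

lemma codeg_measurable [measurable]: "case_prod codeg \<in> borel_measurable (M \<Otimes>\<^sub>M M)"
  unfolding codeg_def by measurable

lemma Z_one: "Z k (\<lambda>_. 1) = (\<Sum>j\<le>k. of_nat (k choose j) * mixed j (k - j) (indicator A) (indicator B))"
proof -
  have "Z k (\<lambda>_. 1) = Z k (\<lambda>x. indicator A x + indicator B x)"
    using disjoint by (intro multi_cong) (auto simp flip: cover split: split_indicator)
  then show ?thesis by (simp add: Z_add)
qed

lemma mixed_0_block: "mixed 0 l (indicator A) (indicator B) = s ^ (l choose 2) * emeasure M B ^ l"
  using Z_block[of "indicator B" B s l] q_B by simp

lemma mixed_block_0: "mixed j 0 (indicator A) (indicator B) = t ^ (j choose 2) * emeasure M A ^ j"
  using Z_block[of "indicator A" A t j] q_A by simp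

text \<open>Once the single vertex \<open>x\<close> of \<open>A\<close> is fixed, the rest is a
  clique inside \<open>B\<close> whose vertex weight has total mass \<open>deg_B x\<close>. Such
  terms are therefore moments of the degrees.\<close>

lemma mixed_1_block:
  "mixed (Suc 0) l (indicator A) (indicator B) = s ^ (l choose 2) * (\<integral>\<^sup>+x. indicator A x * deg_B x ^ l \<partial>M)"
proof -
  have "mixed (Suc 0) l (indicator A) (indicator B) =
    (\<integral>\<^sup>+x. indicator A x * Z l (\<lambda>y. indicator B y * q y x) \<partial>M)"
    by (subst mixed_Suc_left) auto
  also have "\<dots> = (\<integral>\<^sup>+x. indicator A x * (s ^ (l choose 2) * deg_B x ^ l) \<partial>M)"
    unfolding deg_B_def
    by (intro nn_integral_cong, subst Z_block[of _ B s]) (auto simp: q_B)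
  also have "\<dots> = s ^ (l choose 2) * (\<integral>\<^sup>+x. indicator A x * deg_B x ^ l \<partial>M)"
    by (subst nn_integral_cmult[symmetric]) (auto simp: mult_ac)
  finally show ?thesis .
qed

lemma mixed_block_1:
  "mixed j (Suc 0) (indicator A) (indicator B) = t ^ (j choose 2) * (\<integral>\<^sup>+y. indicator B y * deg_A y ^ j \<partial>M)"
proof -
  have "mixed j (Suc 0) (indicator A) (indicator B) =
    (\<integral>\<^sup>+y. indicator B y * Z j (\<lambda>x. indicator A x * q x y) \<partial>M)"
    by (subst mixed_Suc_right) auto
  also have "\<dots> = (\<integral>\<^sup>+y. indicator B y * (t ^ (j choose 2) * deg_A y ^ j) \<partial>M)"
    unfolding deg_A_def
    by (intro nn_integral_cong, subst Z_block[of _ A t]) (auto simp: q_A)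
  also have "\<dots> = t ^ (j choose 2) * (\<integral>\<^sup>+y. indicator B y * deg_A y ^ j \<partial>M)"
    by (subst nn_integral_cmult[symmetric]) (auto simp: mult_ac)
  finally show ?thesis .
qed

text \<open>For fixed \<open>x\<close> and \<open>x'\<close> in \<open>A\<close>, the two vertices
  in \<open>B\<close> carry a weight of total mass \<open>codeg x x'\<close>. The four cross edges
  form a four-cycle; the remaining two edges give \<open>t\<close> and \<open>s\<close>.\<close>

lemma mixed_2_2:
  "mixed (Suc (Suc 0)) 2 (indicator A) (indicator B) =
     t * s * (\<integral>\<^sup>+x. \<integral>\<^sup>+x'. indicator A x * indicator A x' * codeg x x' ^ 2 \<partial>M \<partial>M)"
proof -
  have "mixed (Suc (Suc 0)) 2 (indicator A) (indicator B) =
    (\<integral>\<^sup>+x. indicator A x * (\<integral>\<^sup>+x'. indicator A x' * q x' x * Z 2 (\<lambda>y. indicator B y * q y x * q y x') \<partial>M) \<partial>M)"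
    by (subst mixed_Suc_left, measurable, intro nn_integral_cong, subst mixed_Suc_left) auto
  also have "\<dots> = (\<integral>\<^sup>+x. indicator A x * (\<integral>\<^sup>+x'. indicator A x' * q x' x * (s * codeg x x' ^ 2) \<partial>M) \<partial>M)"
    unfolding codeg_def
    by (intro nn_integral_cong arg_cong2[where f="(*)"] refl, subst Z_block[of _ B s]) (auto simp: q_B)
  also have "\<dots> = (\<integral>\<^sup>+x. \<integral>\<^sup>+x'. (t * s) * (indicator A x * indicator A x' * codeg x x' ^ 2) \<partial>M \<partial>M)"
    by (intro nn_integral_cong, subst nn_integral_cmult[symmetric])
      (auto simp: q_A mult_ac intro!: nn_integral_cong split: split_indicator)
  also have "\<dots> = t * s * (\<integral>\<^sup>+x. \<integral>\<^sup>+x'. indicator A x * indicator A x' * codeg x x' ^ 2 \<partial>M \<partial>M)"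
    by (subst nn_integral_cmult[symmetric], measurable, intro nn_integral_cong, subst nn_integral_cmult[symmetric])
      simp_all
  finally show ?thesis .
qed

lemma Z_one_eq_block_sum:
  assumes "\<And>x y. x \<in> A \<Longrightarrow> y \<in> B \<Longrightarrow> q x y = \<kappa>"
  shows "Z k (\<lambda>_. 1) = block_sum (emeasure M A) (emeasure M B) t s \<kappa> k"
  unfolding Z_one block_sum_def
  by (subst mixed_block[of _ A _ B t s \<kappa>]) (auto simp: q_A q_B assms mult_ac)

text \<open>With \<open>t = 0\<close> every term having two or more vertices in \<open>A\<close>
  vanishes. What remains for 2 and 3 vertices, beside the known clique inside \<open>B\<close>, is
  the first and the second moment of the degrees.\<close>

lemma deg_B_const:
  assumes "t = 0" "s = 1" and p: "p < \<infinity>"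
    and "Z 2 (\<lambda>_. 1) = block_sum (emeasure M A) (emeasure M B) t s p 2"
    and "Z 3 (\<lambda>_. 1) = block_sum (emeasure M A) (emeasure M B) t s p 3"
  shows "AE x in M. x \<in> A \<longrightarrow> deg_B x = p * emeasure M B"
proof -
  let ?a = "emeasure M A" and ?b = "emeasure M B"
  have fin: "?a < \<infinity>" "?b < \<infinity>" by (auto simp: less_top[symmetric])
  have "?b ^ 2 + 2 * (\<integral>\<^sup>+x. indicator A x * deg_B x \<partial>M) = ?b ^ 2 + 2 * (p * ?b * ?a)"
    using assms(4) mixed_1_block[of 1] \<open>t = 0\<close> \<open>s = 1\<close> 
    by (simp add: Z_one block_sum_def numeral_2_eq_2 mixed_0_block mixed_block_0 mult_ac del: mixed_0 mixed_0_right)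
  moreover have "?b ^ 3 + 3 * (\<integral>\<^sup>+x. indicator A x * deg_B x ^ 2 \<partial>M) = ?b ^ 3 + 3 * ((p * ?b) ^ 2 * ?a)"
    using assms(5) mixed_1_block[of 2] mixed_block_1[of 2] \<open>t = 0\<close> \<open>s = 1\<close>
    by (simp add: Z_one block_sum_def numeral_2_eq_2 numeral_3_eq_3 power_mult_distrib mixed_0_block mixed_block_0 mult_ac
      del: mixed_0 mixed_0_right)
  ultimately have "(\<integral>\<^sup>+x. indicator A x * deg_B x \<partial>M) = p * ?b * ?a"
    "(\<integral>\<^sup>+x. indicator A x * deg_B x ^ 2 \<partial>M) = (p * ?b) ^ 2 * ?a"
    using fin by (auto simp: ennreal_add_left_cancel ennreal_mult_cancel_left power_eq_top_ennreal)
  then show ?thesis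
    using fin p by (intro AE_eq_if_moments_eq) (auto simp: ennreal_mult_less_top)
qed


text \<open>Both sides count, with weights, the paths of two edges from \<open>S\<close> to
  \<open>T\<close> whose centre lies in \<open>B\<close>. For \<open>S = T\<close> this is the
  second moment of the row integrals over \<open>S\<close>.\<close>

lemma integral_codeg:
  assumes [measurable]: "S \<in> sets M" "T \<in> sets M"
  shows "(\<integral>\<^sup>+x. \<integral>\<^sup>+x'. indicator S x * indicator T x' * codeg x x' \<partial>M \<partial>M) =
    (\<integral>\<^sup>+y. indicator B y * ((\<integral>\<^sup>+x. indicator S x * q x y \<partial>M) * (\<integral>\<^sup>+x. indicator T x * q x y \<partial>M)) \<partial>M)"
proof -
  interpret pair_sigma_finite M M ..
  have "(\<integral>\<^sup>+x. \<integral>\<^sup>+x'. indicator S x * indicator T x' * codeg x x' \<partial>M \<partial>M) =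
    (\<integral>\<^sup>+x. \<integral>\<^sup>+x'. \<integral>\<^sup>+y. indicator S x * indicator T x' * (indicator B y * q y x * q y x') \<partial>M \<partial>M \<partial>M)"
    unfolding codeg_def by (intro nn_integral_cong, subst nn_integral_cmult[symmetric]) simp_all
  also have "\<dots> = (\<integral>\<^sup>+x. \<integral>\<^sup>+y. \<integral>\<^sup>+x'. indicator S x * indicator T x' * (indicator B y * q y x * q y x') \<partial>M \<partial>M \<partial>M)"
    by (intro nn_integral_cong Fubini') measurable
  also have "\<dots> = (\<integral>\<^sup>+y. \<integral>\<^sup>+x. \<integral>\<^sup>+x'. indicator S x * indicator T x' * (indicator B y * q y x * q y x') \<partial>M \<partial>M \<partial>M)"
    by (rule Fubini') measurable
  also have "\<dots> = (\<integral>\<^sup>+y. \<integral>\<^sup>+x. (indicator S x * q x y) * (indicator B y * (\<integral>\<^sup>+x'. indicator T x' * q x' y \<partial>M)) \<partial>M \<partial>M)"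
    by (intro nn_integral_cong, subst nn_integral_cmult[symmetric], measurable, 
        subst nn_integral_cmult[symmetric], measurable)
      (auto intro!: nn_integral_cong simp: q_sym[of _ "_"] mult_ac)
  also have "\<dots> = (\<integral>\<^sup>+y. indicator B y * ((\<integral>\<^sup>+x. indicator S x * q x y \<partial>M) * (\<integral>\<^sup>+x. indicator T x * q x y \<partial>M)) \<partial>M)"
    by (intro nn_integral_cong, subst nn_integral_multc) (auto simp: mult_ac)
  finally show ?thesis .
qed

text \<open>
  On four vertices the unknown contribution of the cross edges is the homomorphism density of
  the four-cycle, which is then minimal, so the codegrees are almost everywhere constant.
\<close>
lemma codeg_const:
  assumes t: "0 < t" "t < \<infinity>" and s: "0 < s" "s < \<infinity>" and \<kappa>: "\<kappa> < \<infinity>"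
    and degB: "AE x in M. x \<in> A \<longrightarrow> deg_B x = \<kappa> * emeasure M B"
    and degA: "AE y in M. y \<in> B \<longrightarrow> deg_A y = \<kappa> * emeasure M A"
    and Z4: "Z 4 (\<lambda>_. 1) = block_sum (emeasure M A) (emeasure M B) t s \<kappa> 4"
  shows "AE z in M \<Otimes>\<^sub>M M. z \<in> A \<times> A \<longrightarrow> case_prod codeg z = \<kappa> ^ 2 * emeasure M B"
proof -
  let ?a = "emeasure M A" and ?b = "emeasure M B"
  let ?I = "\<integral>\<^sup>+x. \<integral>\<^sup>+x'. indicator A x * indicator A x' * codeg x x' ^ 2 \<partial>M \<partial>M"
  let ?X = "\<lambda>j. of_nat (4 choose j) * (t ^ (j choose 2) * s ^ ((4 - j) choose 2) * \<kappa> ^ (j * (4 - j)) * ?a ^ j * ?b ^ (4 - j))"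
  let ?Y = "\<lambda>j. of_nat (4 choose j) * mixed j (4 - j) (indicator A) (indicator B)"
  have fin: "?a < \<infinity>" "?b < \<infinity>" by (auto simp: less_top[symmetric])
  have X_fin: "?X j < \<infinity>" for j
    using fin t s \<kappa> by (auto simp: ennreal_mult_less_top power_less_top_ennreal of_nat_less_top)
  have "(\<integral>\<^sup>+x. indicator A x * deg_B x ^ 3 \<partial>M) = (\<integral>\<^sup>+x. (\<kappa> * ?b) ^ 3 * indicator A x \<partial>M)"
    by (rule nn_integral_cong_AE, use degB in eventually_elim) (auto split: split_indicator)
  also have "\<dots> = (\<kappa> * ?b) ^ 3 * ?a" by (simp add: nn_integral_cmult)
  finally have Y1: "?Y 1 = ?X 1"
    using mixed_1_block[of 3] by (simp add: binomial_eq_0 power_mult_distrib mult_ac)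
  have "(\<integral>\<^sup>+x. indicator B x * deg_A x ^ 3 \<partial>M) = (\<integral>\<^sup>+x. (\<kappa> * ?a) ^ 3 * indicator B x \<partial>M)"
    by (rule nn_integral_cong_AE, use degA in eventually_elim) (auto split: split_indicator)
  also have "\<dots> = (\<kappa> * ?a) ^ 3 * ?b" by (simp add: nn_integral_cmult)
  finally have Y3: "?Y 3 = ?X 3"
    using mixed_block_1[of 3] by (simp add: binomial_eq_0 power_mult_distrib mult_ac)
  have Y0: "?Y 0 = ?X 0" using mixed_0_block[of 4] by simp
  have Y4: "?Y 4 = ?X 4" using mixed_block_0[of 4] by simp
  have sum5: "(\<Sum>j\<le>4. f j) = (f 0 + f 1 + f 3 + f 4) + f 2" for f :: "nat \<Rightarrow> ennreal"
    by (simp add: eval_nat_numeral add_ac)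
  have "(?X 0 + ?X 1 + ?X 3 + ?X 4) + ?Y 2 = (?X 0 + ?X 1 + ?X 3 + ?X 4) + ?X 2"
    using Z4 unfolding Z_one block_sum_def sum5 Y0 Y1 Y3 Y4 .
  moreover have "?X 0 + ?X 1 + ?X 3 + ?X 4 \<noteq> \<infinity>"
    using X_fin[of 0] X_fin[of 1] X_fin[of 3] X_fin[of 4] by (simp only: infinity_ennreal_def ennreal_add_eq_top) auto
  ultimately have "?Y 2 = ?X 2" by (subst (asm) ennreal_add_left_cancel) blast
  \<comment> \<open>Positivity of \<open>t\<close> and \<open>s\<close> enters here: the four-cycle
    density can be recovered only after cancelling the factor \<open>6 * t * s\<close>.\<close>
  then have "of_nat (4 choose 2) * t * s * ?I = of_nat (4 choose 2) * t * s * (\<kappa> ^ 4 * ?a ^ 2 * ?b ^ 2)"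
    using mixed_2_2 by (simp add: numeral_2_eq_2 power4_eq_xxxx mult_ac)
  then have I: "?I = \<kappa> ^ 4 * ?a ^ 2 * ?b ^ 2"
    using t s by (subst (asm) ennreal_mult_cancel_left)
      (auto simp: ennreal_mult_eq_top_iff binomial_eq_0_iff)
  have AA: "emeasure (M \<Otimes>\<^sub>M M) (A \<times> A) = ?a * ?a" by (rule emeasure_pair_measure_Times) auto
  have fib: "(\<integral>\<^sup>+z. indicator (A \<times> A) z * f z \<partial>(M \<Otimes>\<^sub>M M)) =
    (\<integral>\<^sup>+x. \<integral>\<^sup>+x'. indicator A x * indicator A x' * f (x, x') \<partial>M \<partial>M)"
    if [measurable]: "f \<in> borel_measurable (M \<Otimes>\<^sub>M M)" for f
    by (subst nn_integral_fst[symmetric]) (auto simp: indicator_times)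
  show ?thesis
  proof (rule AE_eq_if_moments_eq)
    have "(\<integral>\<^sup>+z. indicator (A \<times> A) z * case_prod codeg z \<partial>(M \<Otimes>\<^sub>M M)) =
      (\<integral>\<^sup>+y. indicator B y * (deg_A y * deg_A y) \<partial>M)"
      unfolding deg_A_def by (subst fib) (simp_all add: integral_codeg)
    also have "\<dots> = (\<integral>\<^sup>+y. (\<kappa> * ?a) ^ 2 * indicator B y \<partial>M)"
      by (rule nn_integral_cong_AE, use degA in eventually_elim) (auto simp: power2_eq_square split: split_indicator)
    also have "\<dots> = \<kappa>\<^sup>2 * ?b * emeasure (M \<Otimes>\<^sub>M M) (A \<times> A)"
      by (subst nn_integral_cmult_indicator) (auto simp: AA power2_eq_square mult_ac)
    finally show "(\<integral>\<^sup>+z. indicator (A \<times> A) z * case_prod codeg z \<partial>(M \<Otimes>\<^sub>M M)) = \<kappa>\<^sup>2 * ?b * emeasure (M \<Otimes>\<^sub>M M) (A \<times> A)" .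
    show "(\<integral>\<^sup>+z. indicator (A \<times> A) z * (case_prod codeg z)\<^sup>2 \<partial>(M \<Otimes>\<^sub>M M)) = (\<kappa>\<^sup>2 * ?b)\<^sup>2 * emeasure (M \<Otimes>\<^sub>M M) (A \<times> A)"
      using I by (subst fib) (simp_all add: AA power_mult_distrib power2_eq_square power4_eq_xxxx mult_ac)
  qed (use fin \<kappa> in \<open>auto simp: AA ennreal_mult_less_top power_less_top_ennreal\<close>)
qed

text \<open>For every \<open>S\<close> inside \<open>A\<close>, the degrees give the first moment
  over \<open>B\<close> of the row integral over \<open>S\<close>, and the constant codegrees give
  the second. So this row integral is almost everywhere \<open>\<kappa>\<close> times the measure of
  \<open>S\<close>, for all such \<open>S\<close>, which forces \<open>q\<close> to be
  \<open>\<kappa>\<close> on the cross block.\<close>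

lemma cross_const:
  assumes t: "0 < t" "t < \<infinity>" and s: "0 < s" "s < \<infinity>" and \<kappa>: "\<kappa> < \<infinity>"
    and degB: "AE x in M. x \<in> A \<longrightarrow> deg_B x = \<kappa> * emeasure M B"
    and degA: "AE y in M. y \<in> B \<longrightarrow> deg_A y = \<kappa> * emeasure M A"
    and Z4: "Z 4 (\<lambda>_. 1) = block_sum (emeasure M A) (emeasure M B) t s \<kappa> 4"
  shows "AE z in M \<Otimes>\<^sub>M M. fst z \<in> A \<longrightarrow> snd z \<in> B \<longrightarrow> q (fst z) (snd z) = \<kappa>"
proof -
  note fst = nn_integral_fst and times = emeasure_pair_measure_Times and sigma_finite_M = sigma_finite_measure_axioms
  interpret pair_sigma_finite M M ..
  let ?b = "emeasure M B"
  have fin: "emeasure M S < \<infinity>" for S by (auto simp: less_top[symmetric])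
  have codeg: "AE z in M \<Otimes>\<^sub>M M. z \<in> A \<times> A \<longrightarrow> case_prod codeg z = \<kappa> ^ 2 * ?b"
    by (rule codeg_const[OF assms])
  have row: "AE y in M. y \<in> B \<longrightarrow> (\<integral>\<^sup>+x. indicator S x * q x y \<partial>M) = \<kappa> * emeasure M S"
    if [measurable]: "S \<in> sets M" and S: "S \<subseteq> A" for S
  proof (rule AE_eq_if_moments_eq)
    have "(\<integral>\<^sup>+y. indicator B y * (\<integral>\<^sup>+x. indicator S x * q x y \<partial>M) \<partial>M) =
      (\<integral>\<^sup>+y. \<integral>\<^sup>+x. indicator B y * (indicator S x * q x y) \<partial>M \<partial>M)"
      by (intro nn_integral_cong, subst nn_integral_cmult) simp_all
    also have "\<dots> = (\<integral>\<^sup>+x. \<integral>\<^sup>+y. indicator B y * (indicator S x * q x y) \<partial>M \<partial>M)"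
      by (rule Fubini') measurable
    also have "\<dots> = (\<integral>\<^sup>+x. indicator S x * deg_B x \<partial>M)"
      unfolding deg_B_def
      by (intro nn_integral_cong, subst nn_integral_cmult[symmetric])
        (auto simp: mult_ac q_sym[of _ "_"] intro!: nn_integral_cong)
    also have "\<dots> = (\<integral>\<^sup>+x. \<kappa> * ?b * indicator S x \<partial>M)"
      by (rule nn_integral_cong_AE, use degB in eventually_elim) (use S in \<open>auto split: split_indicator\<close>)
    also have "\<dots> = \<kappa> * emeasure M S * ?b"
      by (subst nn_integral_cmult_indicator) (auto simp: mult_ac)
    finally show "(\<integral>\<^sup>+y. indicator B y * (\<integral>\<^sup>+x. indicator S x * q x y \<partial>M) \<partial>M) = \<kappa> * emeasure M S * ?b" .
    have "(\<integral>\<^sup>+y. indicator B y * (\<integral>\<^sup>+x. indicator S x * q x y \<partial>M)\<^sup>2 \<partial>M) =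
      (\<integral>\<^sup>+x. \<integral>\<^sup>+x'. indicator S x * indicator S x' * codeg x x' \<partial>M \<partial>M)"
      by (simp add: integral_codeg power2_eq_square)
    also have "\<dots> = (\<integral>\<^sup>+z. indicator (S \<times> S) z * case_prod codeg z \<partial>(M \<Otimes>\<^sub>M M))"
      by (subst fst[symmetric]) (auto simp: indicator_times)
    also have "\<dots> = (\<integral>\<^sup>+z. \<kappa>\<^sup>2 * ?b * indicator (S \<times> S) z \<partial>(M \<Otimes>\<^sub>M M))"
      by (rule nn_integral_cong_AE, use codeg in eventually_elim) (use S in \<open>auto split: split_indicator\<close>)
    also have "\<dots> = \<kappa>\<^sup>2 * ?b * (emeasure M S * emeasure M S)"
      by (simp add: nn_integral_cmult times)
    also have "\<dots> = (\<kappa> * emeasure M S)\<^sup>2 * ?b" by (simp add: power2_eq_square mult_ac)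
    finally show "(\<integral>\<^sup>+y. indicator B y * (\<integral>\<^sup>+x. indicator S x * q x y \<partial>M)\<^sup>2 \<partial>M) = (\<kappa> * emeasure M S)\<^sup>2 * ?b" .
  qed (use fin \<kappa> in \<open>auto simp: ennreal_mult_less_top\<close>)
  let ?f = "\<lambda>z. indicator A (fst z) * indicator B (snd z) * q (fst z) (snd z)"
  have sf: "sigma_finite_measure (density M (\<lambda>y. c * indicator B y))" if "c < \<infinity>" for c
  proof -
    have "emeasure (density M (\<lambda>y. c * indicator B y)) (space M) < \<infinity>"
      using that fin by (simp add: emeasure_density nn_integral_cmult ennreal_mult_less_top)
    then interpret finite_measure "density M (\<lambda>y. c * indicator B y)"
      by (intro finite_measureI) auto
    show ?thesis by unfold_locales
  qed
  have sfA: "sigma_finite_measure (density M (indicator A))"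
  proof -
    interpret finite_measure "density M (indicator A)"
      using fin by (intro finite_measureI) (auto simp: emeasure_density)
    show ?thesis by unfold_locales
  qed
  \<comment> \<open>The null set in \<open>row\<close> depends on \<open>S\<close>, so the pointwise
    statement is reached through measures: the two sides agree on rectangles, and densities are
    unique almost everywhere.\<close>
  have "density M (indicator A) \<Otimes>\<^sub>M density M (\<lambda>y. \<kappa> * indicator B y) = density (M \<Otimes>\<^sub>M M) ?f"
  proof (rule pair_measure_eqI[OF sfA sf[OF \<kappa>]])
    fix S T assume "S \<in> sets (density M (indicator A))" "T \<in> sets (density M (\<lambda>y. \<kappa> * indicator B y))"
    then have [measurable]: "S \<in> sets M" "T \<in> sets M" by auto
    have "emeasure (density (M \<Otimes>\<^sub>M M) ?f) (S \<times> T) = (\<integral>\<^sup>+z. ?f z * indicator (S \<times> T) z \<partial>(M \<Otimes>\<^sub>M M))"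
      by (rule emeasure_density) measurable
    also have "\<dots> = (\<integral>\<^sup>+y. \<integral>\<^sup>+x. ?f (x, y) * indicator (S \<times> T) (x, y) \<partial>M \<partial>M)"
      by (subst nn_integral_snd[symmetric]) simp_all
    also have "\<dots> = (\<integral>\<^sup>+y. indicator T y * indicator B y * (\<integral>\<^sup>+x. indicator (A \<inter> S) x * q x y \<partial>M) \<partial>M)"
      by (intro nn_integral_cong, subst nn_integral_cmult[symmetric])
        (auto simp: indicator_times indicator_inter_arith mult_ac intro!: nn_integral_cong)
    also have "\<dots> = (\<integral>\<^sup>+y. \<kappa> * emeasure M (A \<inter> S) * indicator (B \<inter> T) y \<partial>M)"
    proof (rule nn_integral_cong_AE)
      have "AE y in M. y \<in> B \<longrightarrow> (\<integral>\<^sup>+x. indicator (A \<inter> S) x * q x y \<partial>M) = \<kappa> * emeasure M (A \<inter> S)"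
        by (rule row) auto
      then show "AE y in M. indicator T y * indicator B y * (\<integral>\<^sup>+x. indicator (A \<inter> S) x * q x y \<partial>M) =
          \<kappa> * emeasure M (A \<inter> S) * indicator (B \<inter> T) y"
        by eventually_elim (auto split: split_indicator)
    qed
    also have "\<dots> = emeasure M (A \<inter> S) * (\<kappa> * emeasure M (B \<inter> T))"
      by (subst nn_integral_cmult_indicator) (auto simp: mult_ac)
    also have "\<dots> = emeasure (density M (indicator A)) S * emeasure (density M (\<lambda>y. \<kappa> * indicator B y)) T"
      by (simp add: emeasure_density nn_integral_cmult mult.assoc flip: indicator_inter_arith)
    finally show "emeasure (density M (indicator A)) S * emeasure (density M (\<lambda>y. \<kappa> * indicator B y)) T =
      emeasure (density (M \<Otimes>\<^sub>M M) ?f) (S \<times> T)" ..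
  qed (simp cong: sets_pair_measure_cong)
  moreover have "density M (indicator A) \<Otimes>\<^sub>M density M (\<lambda>y. \<kappa> * indicator B y) =
    density (M \<Otimes>\<^sub>M M) (\<lambda>(x, y). indicator A x * (\<kappa> * indicator B y))"
    by (rule pair_measure_density) (auto intro: sigma_finite_M sf[OF \<kappa>])
  ultimately have "AE z in M \<Otimes>\<^sub>M M. (\<lambda>(x, y). indicator A x * (\<kappa> * indicator B y)) z = ?f z"
    by (subst P.density_unique_iff[symmetric]) auto
  then show ?thesis
    by eventually_elim (auto split: split_indicator_asm)
qed

end

section \<open>Clique densities determine the step kernel\<close>

definition clique_density :: "'a measure \<Rightarrow> ('a \<Rightarrow> 'a \<Rightarrow> ennreal) \<Rightarrow> nat \<Rightarrow> ennreal" where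
  "clique_density M q k = (\<integral>\<^sup>+x. (\<Prod>e\<in>vertex_pairs k. q (x (fst e)) (x (snd e))) \<partial>Pi\<^sub>M {1..k} (\<lambda>_. M))"

lemma (in sym_kernel) Z_one_eq_clique_density: "Z k (\<lambda>_. 1) = clique_density M q k"
  by (simp add: multi_def clique_density_def)

section \<open>Null sets of pairs, seen from a sample of points\<close>

lemma distr_PiM_pair:
  assumes "prob_space M" "i \<in> I" "j \<in> I" "i \<noteq> j"
  shows "distr (Pi\<^sub>M I (\<lambda>_. M)) (M \<Otimes>\<^sub>M M) (\<lambda>x. (x i, x j)) = M \<Otimes>\<^sub>M M"
proof -
  interpret prob_space M by fact
  interpret P: product_prob_space "\<lambda>_. M" I by unfold_locales
  note [measurable] = \<open>i \<in> I\<close> \<open>j \<in> I\<close>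
  have "M \<Otimes>\<^sub>M M = distr (Pi\<^sub>M I (\<lambda>_. M)) (M \<Otimes>\<^sub>M M) (\<lambda>x. (x i, x j))"
  proof (rule pair_measure_eqI)
    fix A B assume [measurable]: "A \<in> sets M" "B \<in> sets M"
    have "emeasure (distr (Pi\<^sub>M I (\<lambda>_. M)) (M \<Otimes>\<^sub>M M) (\<lambda>x. (x i, x j))) (A \<times> B) =
      emeasure (Pi\<^sub>M I (\<lambda>_. M)) (prod_emb I (\<lambda>_. M) {i, j} (Pi\<^sub>E {i, j} (\<lambda>l. if l = i then A else B)))"
      using assms by (subst emeasure_distr)
        (auto simp: prod_emb_def space_PiM PiE_iff intro!: arg_cong2[where f=emeasure])
    also have "\<dots> = emeasure M A * emeasure M B"
      using assms by (subst P.emeasure_PiM_emb) auto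
    finally show "emeasure M A * emeasure M B =
      emeasure (distr (Pi\<^sub>M I (\<lambda>_. M)) (M \<Otimes>\<^sub>M M) (\<lambda>x. (x i, x j))) (A \<times> B)" ..
  qed (auto intro: sigma_finite_measure_axioms)
  then show ?thesis ..
qed

text \<open>Two coordinates with distinct indices have joint law
  \<open>M \<Otimes>\<^sub>M M\<close>, so each of the finitely many vertex pairs avoids a given
  null set almost surely.\<close>

lemma AE_vertex_pairs:
  assumes "prob_space M" and P: "AE z in M \<Otimes>\<^sub>M M. P (fst z) (snd z)"
  shows "AE x in Pi\<^sub>M {1..k} (\<lambda>_. M). \<forall>e\<in>vertex_pairs k. P (x (fst e)) (x (snd e))"
proof (rule AE_finite_allI[OF finite_vertex_pairs])
  fix e assume "e \<in> vertex_pairs k"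
  then have e: "fst e \<in> {1..k}" "snd e \<in> {1..k}" "fst e \<noteq> snd e" by (auto simp: vertex_pairs_def)
  note [measurable] = e(1,2)
  have *: "AE z in distr (Pi\<^sub>M {1..k} (\<lambda>_. M)) (M \<Otimes>\<^sub>M M) (\<lambda>x. (x (fst e), x (snd e))). P (fst z) (snd z)"
    using P by (simp only: distr_PiM_pair[OF assms(1) e])
  have "(\<lambda>x. (x (fst e), x (snd e))) \<in> measurable (Pi\<^sub>M {1..k} (\<lambda>_. M)) (M \<Otimes>\<^sub>M M)"
    by measurable
  from AE_distrD[OF this *] show "AE x in Pi\<^sub>M {1..k} (\<lambda>_. M). P (x (fst e)) (x (snd e))"
    by simp
qed

lemma clique_density_cong_AE:
  assumes "prob_space M" and "AE z in M \<Otimes>\<^sub>M M. q (fst z) (snd z) = q' (fst z) (snd z)"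
  shows "clique_density M q k = clique_density M q' k"
  unfolding clique_density_def
  by (rule nn_integral_cong_AE, use AE_vertex_pairs[OF assms, of k] in eventually_elim)
    (auto intro!: prod.cong)

lemma AE_pair_swap:
  assumes "sigma_finite_measure M" and P: "AE z in M \<Otimes>\<^sub>M M. P (fst z) (snd z)"
  shows "AE z in M \<Otimes>\<^sub>M M. P (snd z) (fst z)"
proof -
  interpret sigma_finite_measure M by fact
  interpret pair_sigma_finite M M ..
  have "AE z in distr (M \<Otimes>\<^sub>M M) (M \<Otimes>\<^sub>M M) (\<lambda>(x, y). (y, x)). P (fst z) (snd z)"
    using P by (subst distr_pair_swap[symmetric])
  from AE_distrD[OF _ this] show ?thesis by (simp add: case_prod_beta')
qed

text \<open>The arguments tell whether each point lies in the part where the kernel is 1. Taking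
  memberships in place of points allows step kernels over different sets to be compared through the
  law of the memberships.\<close>

definition step :: "real \<Rightarrow> bool \<Rightarrow> bool \<Rightarrow> real" where
  "step p b c = (if b \<and> c then 1 else if \<not> b \<and> \<not> c then 0 else p)"

text \<open>For nonnegative \<open>s\<close> and \<open>t\<close>, the mean weight of a pair when an
  edge weighs \<open>s\<close> and a non-edge weighs \<open>t\<close>.\<close>

definition two_weight :: "real \<Rightarrow> real \<Rightarrow> ('a \<Rightarrow> 'a \<Rightarrow> real) \<Rightarrow> 'a \<Rightarrow> 'a \<Rightarrow> ennreal" where
  "two_weight s t u x y = ennreal (s * u x y + t * (1 - u x y))"

text \<open>Symmetry and bounds hold at every point, so that they can be used pointwise;
  \<open>ex_sym_graphon_AE_eq\<close> provides such a version of a graphon.\<close>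

locale sym_graphon = prob_space M for M :: "'a measure" +
  fixes u :: "'a \<Rightarrow> 'a \<Rightarrow> real"
  assumes u_measurable [measurable]: "case_prod u \<in> borel_measurable (M \<Otimes>\<^sub>M M)"
    and u_sym: "u x y = u y x"
    and u_nonneg: "0 \<le> u x y" and u_le_1: "u x y \<le> 1"
begin

lemma sym_kernel_two_weight: "sym_kernel M (two_weight s t u)"
proof
  have [measurable]: "(\<lambda>z. u (fst z) (snd z)) \<in> borel_measurable (M \<Otimes>\<^sub>M M)"
    using u_measurable by (simp add: case_prod_beta')
  show "case_prod (two_weight s t u) \<in> borel_measurable (M \<Otimes>\<^sub>M M)"
    unfolding two_weight_def case_prod_beta' by measurable
qed (simp add: two_weight_def u_sym)

lemma block_kernel_two_weight:
  assumes "A \<in> sets M" "B \<in> sets M" "A \<inter> B = {}" "A \<union> B = space M"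
    and "\<And>x y. x \<in> A \<Longrightarrow> y \<in> A \<Longrightarrow> u x y = 0" "\<And>x y. x \<in> B \<Longrightarrow> y \<in> B \<Longrightarrow> u x y = 1"
  shows "block_kernel M (two_weight s t u) A B (ennreal t) (ennreal s)"
proof -
  interpret K: sym_kernel M "two_weight s t u" by (rule sym_kernel_two_weight)
  show ?thesis using assms by unfold_locales (auto simp: two_weight_def)
qed

end

lemma sym_graphon_step:
  assumes "prob_space M" and [measurable]: "B \<in> sets M" and p: "0 \<le> p" "p \<le> 1"
  shows "sym_graphon M (\<lambda>x y. step p (x \<in> B) (y \<in> B))"
proof -
  interpret prob_space M by fact
  show ?thesis
  proof
    show "(\<lambda>(x, y). step p (x \<in> B) (y \<in> B)) \<in> borel_measurable (M \<Otimes>\<^sub>M M)"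
      unfolding step_def by measurable
  qed (use p in \<open>auto simp: step_def\<close>)
qed

lemma clique_density_step:
  assumes "prob_space M" and [measurable]: "B \<in> sets M" and p: "0 \<le> p" "p \<le> 1"
    and b: "emeasure M B = ennreal b" "0 \<le> b" "b \<le> 1"
  shows "clique_density M (two_weight s t (\<lambda>x y. step p (x \<in> B) (y \<in> B))) k =
    block_sum (ennreal (1 - b)) (ennreal b) (ennreal t) (ennreal s) (ennreal (s * p + t * (1 - p))) k"
proof -
  interpret sym_graphon M "\<lambda>x y. step p (x \<in> B) (y \<in> B)"
    by (rule sym_graphon_step) fact+
  have BM: "B \<subseteq> space M" by (rule sets.sets_into_space) fact
  interpret block_kernel M "two_weight s t (\<lambda>x y. step p (x \<in> B) (y \<in> B))" "space M - B" B "ennreal t" "ennreal s"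
    using BM by (intro block_kernel_two_weight) (auto simp: step_def)
  have "emeasure M (space M - B) = ennreal (1 - b)"
    using b by (subst emeasure_compl) (auto simp: emeasure_space_1 ennreal_minus ennreal_1[symmetric] simp del: ennreal_1)
  then show ?thesis
    unfolding Z_one_eq_clique_density[symmetric]
    by (subst Z_one_eq_block_sum) (auto simp: b two_weight_def step_def)
qed

lemma block_sum_swap: "block_sum a b t s \<kappa> k = block_sum b a s t \<kappa> k"
  unfolding block_sum_def
  by (rule sum.reindex_bij_witness[of _ "\<lambda>j. k - j" "\<lambda>j. k - j"])
    (auto simp: binomial_symmetric[symmetric] mult_ac)

text \<open>The term \<open>j = 0\<close>, in which all vertices lie in the second part, is already
  \<open>b ^ k\<close>.\<close>

lemma power_le_block_sum: "b ^ k \<le> block_sum a b 0 1 \<kappa> k"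
proof -
  have "b ^ k = (\<Sum>j\<in>{0}. of_nat (k choose j) *
     (0 ^ (j choose 2) * 1 ^ ((k - j) choose 2) * \<kappa> ^ (j * (k - j)) * a ^ j * b ^ (k - j)))" by simp
  also have "\<dots> \<le> block_sum a b 0 1 \<kappa> k"
    unfolding block_sum_def by (rule sum_mono2) auto
  finally show ?thesis .
qed

text \<open>The weights \<open>(1, 0)\<close> and \<open>(0, 1)\<close> recover the diagonal blocks
  and then the degrees between them; the weights \<open>(2, 1)\<close> recover the values
  across.\<close>

theorem (in sym_graphon) step_if_clique_densities:
  assumes p: "0 \<le> p" "p \<le> 1" and b: "0 \<le> b" "b \<le> 1"
    and dens: "\<And>s t k. 0 \<le> s \<Longrightarrow> 0 \<le> t \<Longrightarrow> k \<ge> 1 \<Longrightarrow> clique_density M (two_weight s t u) k =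
      block_sum (ennreal (1 - b)) (ennreal b) (ennreal t) (ennreal s) (ennreal (s * p + t * (1 - p))) k"
  obtains B where "B \<in> sets M" "emeasure M B = ennreal b"
    "AE z in M \<Otimes>\<^sub>M M. u (fst z) (snd z) = step p (fst z \<in> B) (snd z \<in> B)"
proof -
  interpret MM: pair_sigma_finite M M ..
  interpret K1: sym_kernel M "two_weight 1 0 u" by (rule sym_kernel_two_weight)
  interpret K0: sym_kernel M "two_weight 0 1 u" by (rule sym_kernel_two_weight)
  obtain B where B [measurable]: "B \<in> sets M" and bB: "ennreal b \<le> emeasure M B"
    and uB: "AE z in M \<Otimes>\<^sub>M M. fst z \<in> B \<longrightarrow> snd z \<in> B \<longrightarrow> two_weight 1 0 u (fst z) (snd z) = 1"
  proof (rule K1.exists_clique)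
    show "two_weight 1 0 u x y \<le> 1" for x y using u_le_1[of x y] by (simp add: two_weight_def)
    show "ennreal b ^ k \<le> K1.Z k (\<lambda>_. 1)" if "k \<ge> 1" for k
      using dens[of 1 0 k] that power_le_block_sum[of "ennreal b" k]
      by (simp add: K1.Z_one_eq_clique_density)
  qed
  obtain A' where A' [measurable]: "A' \<in> sets M" and aA': "ennreal (1 - b) \<le> emeasure M A'"
    and uA': "AE z in M \<Otimes>\<^sub>M M. fst z \<in> A' \<longrightarrow> snd z \<in> A' \<longrightarrow> two_weight 0 1 u (fst z) (snd z) = 1"
  proof (rule K0.exists_clique)
    show "two_weight 0 1 u x y \<le> 1" for x y using u_nonneg[of x y] by (simp add: two_weight_def)
    show "ennreal (1 - b) ^ k \<le> K0.Z k (\<lambda>_. 1)" if "k \<ge> 1" for k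
      using dens[of 0 1 k] that power_le_block_sum[of "ennreal (1 - b)" k]
      by (simp add: K0.Z_one_eq_clique_density block_sum_swap[of "ennreal (1 - b)"])
  qed
  have u1: "AE z in M \<Otimes>\<^sub>M M. fst z \<in> B \<longrightarrow> snd z \<in> B \<longrightarrow> u (fst z) (snd z) = 1"
    using uB by eventually_elim (simp add: two_weight_def ennreal_eq_1)
  have u0: "AE z in M \<Otimes>\<^sub>M M. fst z \<in> A' \<longrightarrow> snd z \<in> A' \<longrightarrow> u (fst z) (snd z) = 0"
    using uA' by eventually_elim (simp add: two_weight_def ennreal_eq_1)
  \<comment> \<open>On this square \<open>u\<close> would have to be both 0 and 1.\<close>
  have "AE z in M \<Otimes>\<^sub>M M. z \<notin> (A' \<inter> B) \<times> (A' \<inter> B)"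
    using u1 u0 by eventually_elim auto
  then have "emeasure (M \<Otimes>\<^sub>M M) ((A' \<inter> B) \<times> (A' \<inter> B)) = 0"
    by (subst (asm) AE_iff_measurable[where N = "(A' \<inter> B) \<times> (A' \<inter> B)"])
      (use sets.sets_into_space[OF B] in \<open>auto simp: space_pair_measure\<close>)
  then have null: "emeasure M (A' \<inter> B) = 0"
    by (simp add: emeasure_pair_measure_Times)
  let ?A = "space M - B"
  have "measure M (A' \<inter> B) = 0" using null by (simp add: measure_def)
  then have mA': "measure M (A' - B) = measure M A'"
    using finite_measure_Diff[of A' "A' \<inter> B"] by (simp add: Diff_Int)
  have ge: "1 - b \<le> measure M A'" "b \<le> measure M B"
    using aA' bB b by (simp_all add: emeasure_eq_measure)
  have comp: "measure M ?A = 1 - measure M B" by (simp add: prob_compl)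
  \<comment> \<open>Two sets that meet in a null set and have measures at least \<open>1 - b\<close>
    and \<open>b\<close> leave no slack, so both bounds are equalities and \<open>A'\<close> is the
    complement of \<open>B\<close> up to a null set.\<close>
  have "measure M (A' - B) \<le> measure M ?A" 
    by (rule finite_measure_mono) (use sets.sets_into_space[OF A'] in auto)
  then have mB: "measure M B = b" and mA: "measure M ?A = 1 - b" and mAA: "measure M (A' - B) = 1 - b"
    using ge mA' comp by auto
  have eB: "emeasure M B = ennreal b" and eA: "emeasure M ?A = ennreal (1 - b)"
    by (simp_all add: emeasure_eq_measure mA mB)
  have "measure M (?A - A') = 0"
  proof -
    have "?A - A' = ?A - (A' - B)" by auto
    also have "measure M \<dots> = measure M ?A - measure M (A' - B)"
      by (rule finite_measure_Diff) (use sets.sets_into_space[OF A'] in auto)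
    finally show ?thesis by (simp add: mA mAA)
  qed
  then have AA': "AE x in M. x \<in> ?A \<longrightarrow> x \<in> A'"
    by (intro AE_I[of _ _ "?A - A'"]) (auto simp: emeasure_eq_measure)
  \<comment> \<open>\<open>block_kernel\<close> asks for the block values at every point, so
    \<open>u\<close> is corrected on a null set; the clique densities do not notice.\<close>
  define v where "v x y = (if x \<in> B \<and> y \<in> B then 1 else if x \<notin> B \<and> y \<notin> B then 0 else u x y)" for x y
  have uv: "AE z in M \<Otimes>\<^sub>M M. u (fst z) (snd z) = v (fst z) (snd z)"
  proof -
    have "AE x in M. AE y in M. (x \<in> ?A \<longrightarrow> x \<in> A') \<and> (y \<in> ?A \<longrightarrow> y \<in> A')"
      using AA' by eventually_elim (use AA' in simp)
    then have "AE z in M \<Otimes>\<^sub>M M. (fst z \<in> ?A \<longrightarrow> fst z \<in> A') \<and> (snd z \<in> ?A \<longrightarrow> snd z \<in> A')"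
      by (intro MM.AE_pair_measure) auto
    with u0 u1 AE_space show ?thesis
      by eventually_elim (auto simp: v_def space_pair_measure)
  qed
  have um [measurable]: "(\<lambda>z. u (fst z) (snd z)) \<in> borel_measurable (M \<Otimes>\<^sub>M M)"
    using u_measurable by (simp add: case_prod_beta')
  interpret V: sym_graphon M v
  proof
    show "case_prod v \<in> borel_measurable (M \<Otimes>\<^sub>M M)"
      unfolding v_def case_prod_beta' by measurable
  qed (auto simp: v_def u_sym u_nonneg u_le_1)
  have V_dens: "clique_density M (two_weight s t v) k =
      block_sum (ennreal (1 - b)) (ennreal b) (ennreal t) (ennreal s) (ennreal (s * p + t * (1 - p))) k"
    if "0 \<le> s" "0 \<le> t" "k \<ge> 1" for s t k
    unfolding dens[OF that, symmetric]
    by (rule clique_density_cong_AE[OF prob_space_axioms], use uv in eventually_elim) (simp add: two_weight_def)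
  have V_block: "block_kernel M (two_weight s t v) ?A B (ennreal t) (ennreal s)" for s t
    by (rule V.block_kernel_two_weight) (use sets.sets_into_space[OF B] in \<open>auto simp: v_def\<close>)
  interpret L1: block_kernel M "two_weight 1 0 v" ?A B 0 1
    using V_block[of 1 0] by simp
  \<comment> \<open>The kernel \<open>1 - v\<close> is 0 on the square of \<open>B\<close> and 1 on
    that of its complement, so the two blocks exchange their roles.\<close>
  interpret L0: block_kernel M "two_weight 0 1 v" B ?A 0 1
    using V_block[of 0 1] by (auto simp: block_kernel_def block_kernel_axioms_def)
  \<comment> \<open>This is the kernel \<open>1 + v\<close>. Its block values 1 and 2 are both
    nonzero, as \<open>cross_const\<close> requires.\<close>
  interpret L2: block_kernel M "two_weight 2 1 v" ?A B 1 2
    using V_block[of 2 1] by (simp add: ennreal_numeral)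
  have tw1: "two_weight 2 1 v x y = 1 + two_weight 1 0 v x y" for x y
    using V.u_nonneg[of x y] by (simp add: two_weight_def flip: ennreal_1 ennreal_plus)
  have tw2: "two_weight 2 1 v x y + two_weight 0 1 v x y = 2" for x y
    using V.u_nonneg[of x y] V.u_le_1[of x y]
    by (simp add: two_weight_def flip: ennreal_numeral ennreal_plus)
  have "AE x in M. x \<in> ?A \<longrightarrow> L1.deg_B x = ennreal p * emeasure M B"
    using V_dens[of 1 0 2] V_dens[of 1 0 3]
    by (intro L1.deg_B_const) (auto simp: L1.Z_one_eq_clique_density eA eB)
  then have degB: "AE x in M. x \<in> ?A \<longrightarrow> L2.deg_B x = (1 + ennreal p) * emeasure M B"
  proof eventually_elim
    fix x assume x: "x \<in> ?A \<longrightarrow> L1.deg_B x = ennreal p * emeasure M B"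
    show "x \<in> ?A \<longrightarrow> L2.deg_B x = (1 + ennreal p) * emeasure M B"
    proof
      assume "x \<in> ?A"
      then have [measurable]: "x \<in> space M" by simp
      have "L2.deg_B x = (\<integral>\<^sup>+y. indicator B y + indicator B y * two_weight 1 0 v y x \<partial>M)"
        unfolding L2.deg_B_def tw1 by (simp add: distrib_left)
      also have "\<dots> = emeasure M B + L1.deg_B x"
        unfolding L1.deg_B_def by (subst nn_integral_add) auto
      finally show "L2.deg_B x = (1 + ennreal p) * emeasure M B"
        using x \<open>x \<in> ?A\<close> by (simp add: distrib_right)
    qed
  qed
  have "AE y in M. y \<in> B \<longrightarrow> L0.deg_B y = ennreal (1 - p) * emeasure M ?A"
    using V_dens[of 0 1 2] V_dens[of 0 1 3] p
    by (intro L0.deg_B_const) (auto simp: L0.Z_one_eq_clique_density eA eB block_sum_swap[of "ennreal b"])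
  then have degA: "AE y in M. y \<in> B \<longrightarrow> L2.deg_A y = (1 + ennreal p) * emeasure M ?A"
  proof eventually_elim
    fix y assume y: "y \<in> B \<longrightarrow> L0.deg_B y = ennreal (1 - p) * emeasure M ?A"
    show "y \<in> B \<longrightarrow> L2.deg_A y = (1 + ennreal p) * emeasure M ?A"
    proof
      assume "y \<in> B"
      then have [measurable]: "y \<in> space M" using sets.sets_into_space[OF B] by auto
      \<comment> \<open>As \<open>(1 + v) + (1 - v) = 2\<close>, the degrees of \<open>1 + v\<close>
        follow from those of \<open>1 - v\<close> by cancelling in a sum.\<close>
      have "L2.deg_A y + L0.deg_B y = (\<integral>\<^sup>+x. indicator ?A x * two_weight 2 1 v x y + indicator ?A x * two_weight 0 1 v x y \<partial>M)"
        unfolding L2.deg_A_def L0.deg_B_def by (subst nn_integral_add) auto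
      also have "\<dots> = (\<integral>\<^sup>+x. 2 * indicator ?A x \<partial>M)"
        by (simp add: tw2 mult.commute flip: distrib_left)
      also have "\<dots> = ennreal (2 * (1 - b))"
        using b by (subst ennreal_mult) (simp_all add: nn_integral_cmult eA)
      finally have *: "L2.deg_A y + ennreal ((1 - p) * (1 - b)) = ennreal (2 * (1 - b))"
        using y \<open>y \<in> B\<close> p b by (simp add: eA ennreal_mult)
      then obtain d where d: "0 \<le> d" "L2.deg_A y = ennreal d"
        by (cases "L2.deg_A y") auto
      have "d + (1 - p) * (1 - b) = 2 * (1 - b)"
        using * d p b by (simp add: ennreal_plus[symmetric] del: ennreal_plus)
      then have "d = (1 + p) * (1 - b)" by (simp add: algebra_simps)
      then show "L2.deg_A y = (1 + ennreal p) * emeasure M ?A"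
        using d p b by (simp add: eA ennreal_mult)
    qed
  qed
  have "AE z in M \<Otimes>\<^sub>M M. fst z \<in> ?A \<longrightarrow> snd z \<in> B \<longrightarrow> two_weight 2 1 v (fst z) (snd z) = 1 + ennreal p"
  proof (rule L2.cross_const[OF _ _ _ _ _ degB degA])
    have "1 + ennreal p = ennreal (2 * p + 1 * (1 - p))"
      using p by (simp flip: ennreal_1 ennreal_plus)
    then show "L2.Z 4 (\<lambda>_. 1) = block_sum (emeasure M ?A) (emeasure M B) 1 2 (1 + ennreal p) 4"
      using V_dens[of 2 1 4] by (simp add: L2.Z_one_eq_clique_density eA eB ennreal_numeral)
  qed auto
  then have AB: "AE z in M \<Otimes>\<^sub>M M. fst z \<in> ?A \<longrightarrow> snd z \<in> B \<longrightarrow> v (fst z) (snd z) = p"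
  proof eventually_elim
    fix z assume *: "fst z \<in> ?A \<longrightarrow> snd z \<in> B \<longrightarrow> two_weight 2 1 v (fst z) (snd z) = 1 + ennreal p"
    have "1 + ennreal p = ennreal (1 + p)" "two_weight 2 1 v (fst z) (snd z) = ennreal (1 + v (fst z) (snd z))"
      using p by (simp_all add: two_weight_def add.commute)
    with * V.u_nonneg[of "fst z" "snd z"] p
    show "fst z \<in> ?A \<longrightarrow> snd z \<in> B \<longrightarrow> v (fst z) (snd z) = p"
      by (simp del: ennreal_plus)
  qed
  have BA: "AE z in M \<Otimes>\<^sub>M M. snd z \<in> ?A \<longrightarrow> fst z \<in> B \<longrightarrow> v (snd z) (fst z) = p"
    by (rule AE_pair_swap[OF sigma_finite_measure_axioms AB])
  have "AE z in M \<Otimes>\<^sub>M M. u (fst z) (snd z) = step p (fst z \<in> B) (snd z \<in> B)"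
    using uv AB BA AE_space
    by eventually_elim (auto simp: step_def v_def u_sym space_pair_measure)
  with that[OF B eB] show thesis by blast
qed

section \<open>Samples of a graphon and their edge counts\<close>

lemma ennreal_divide_one: "x / 1 = (x :: ennreal)"
  by (simp add: divide_ennreal_def)

section \<open>The uniform measure and Borel versions of graphons\<close>

definition unit_interval :: "real measure" where
  "unit_interval = uniform_measure lborel {0..1}"

lemma prob_space_unit_interval: "prob_space unit_interval"
  unfolding unit_interval_def by (rule prob_space_uniform_measure) auto

lemma sets_unit_interval [measurable_cong]: "sets unit_interval = sets borel"
  by (simp add: unit_interval_def)

lemma space_unit_interval [simp]: "space unit_interval = UNIV"
  by (simp add: unit_interval_def)

lemma unit_interval_eq_density: "unit_interval = density lborel (indicator {0..1})"
  by (simp add: unit_interval_def uniform_measure_def ennreal_divide_one)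

lemma AE_unit_square_iff:
  "(AE z in unit_interval \<Otimes>\<^sub>M unit_interval. P z) \<longleftrightarrow>
    (AE z in lborel. z \<in> {0..1} \<times> {0..1} \<longrightarrow> P z)"
proof -
  have "unit_interval \<Otimes>\<^sub>M unit_interval =
    density (lborel \<Otimes>\<^sub>M lborel) (\<lambda>(x, y). indicator {0..1} x * indicator {0..1} y)"
    unfolding unit_interval_eq_density
    using prob_space_unit_interval[unfolded unit_interval_eq_density]
    by (intro pair_measure_density) (auto simp: prob_space_def finite_measure_def sigma_finite_lborel)
  also have "\<dots> = density lborel (indicator ({0..1} \<times> {0..1}))"
    by (intro arg_cong2[where f=density] ext) (auto simp: lborel_prod indicator_times)
  finally have *: "unit_interval \<Otimes>\<^sub>M unit_interval = density lborel (indicator ({0..1} \<times> {0..1}))" .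
  have [measurable]: "{0..1::real} \<times> {0..1::real} \<in> sets borel"
    by (intro borel_closed closed_Times) auto
  show ?thesis
    unfolding * by (subst AE_density) (auto intro!: AE_cong simp: indicator_def)
qed

text \<open>Extended by 0, \<open>U\<close> is Lebesgue measurable and so agrees almost everywhere
  with a Borel function \<open>g\<close>. Clamping \<open>g\<close> to the unit interval and
  averaging it with its transpose give bounds and symmetry everywhere; almost everywhere nothing
  changes, because \<open>U\<close> has both on the square.\<close>

lemma ex_sym_graphon_AE_eq:
  assumes "graphon U"
  obtains u where "sym_graphon unit_interval u"
    "AE z in unit_interval \<Otimes>\<^sub>M unit_interval. U (fst z) (snd z) = u (fst z) (snd z)"
proof -
  let ?S = "{0..1::real} \<times> {0..1::real}"
  have "case_prod U \<in> borel_measurable (lebesgue_on ?S)"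
    and sym: "\<And>x y. x \<in> {0..1} \<Longrightarrow> y \<in> {0..1} \<Longrightarrow> U x y = U y x"
    and range: "\<And>x y. x \<in> {0..1} \<Longrightarrow> y \<in> {0..1} \<Longrightarrow> U x y \<in> {0..1}"
    using assms by (auto simp: graphon_def)
  then have "(\<lambda>z. if z \<in> ?S then case_prod U z else 0) \<in> borel_measurable lebesgue"
    by (intro borel_measurable_if_I) (auto intro!: sets_completionI_sets borel_closed closed_Times)
  from completion_ex_borel_measurable_real[OF this]
  obtain g where [measurable]: "g \<in> borel_measurable lborel"
    and g: "AE z in lborel. (if z \<in> ?S then case_prod U z else 0) = g z" by auto
  define c where "c r = min 1 (max 0 r)" for r :: real
  define u where "u x y = (c (g (x, y)) + c (g (y, x))) / 2" for x y
  have 1: "AE z in unit_interval \<Otimes>\<^sub>M unit_interval. fst z \<in> {0..1} \<and> snd z \<in> {0..1} \<and> U (fst z) (snd z) = g (fst z, snd z)"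
    unfolding AE_unit_square_iff using g by eventually_elim auto
  have 2: "AE z in unit_interval \<Otimes>\<^sub>M unit_interval. U (snd z) (fst z) = g (snd z, fst z)"
    using prob_space_unit_interval 1
    by (intro AE_pair_swap[where P = "\<lambda>x y. U x y = g (x, y)"])
      (auto simp: prob_space_def finite_measure_def)
  show thesis
  proof
    interpret prob_space unit_interval by (rule prob_space_unit_interval)
    show "sym_graphon unit_interval u"
    proof
      show "case_prod u \<in> borel_measurable (unit_interval \<Otimes>\<^sub>M unit_interval)"
        unfolding u_def c_def by measurable
    qed (auto simp: u_def c_def)
    show "AE z in unit_interval \<Otimes>\<^sub>M unit_interval. U (fst z) (snd z) = u (fst z) (snd z)"
      using 1 2
    proof eventually_elim
      fix z assume *: "fst z \<in> {0..1} \<and> snd z \<in> {0..1} \<and> U (fst z) (snd z) = g (fst z, snd z)"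
        "U (snd z) (fst z) = g (snd z, fst z)"
      have "c (U (fst z) (snd z)) = U (fst z) (snd z)"
        using range[of "fst z" "snd z"] * by (auto simp: c_def)
      then show "U (fst z) (snd z) = u (fst z) (snd z)"
        using sym[of "snd z" "fst z"] * by (simp add: u_def)
    qed
  qed
qed

section \<open>Measurability of the sampling kernel\<close>

lemma random_graph_pmf_cong:
  assumes "\<And>e. e \<in> vertex_pairs k \<Longrightarrow> q (fst e) (snd e) = q' (fst e) (snd e)"
  shows "random_graph_pmf k q = random_graph_pmf k q'"
  unfolding random_graph_pmf_def using assms
  by (intro arg_cong2[where f=map_pmf] Pi_pmf_cong refl) auto

text \<open>The probability of any set of graphs is a finite sum, over the choices of edges, of
  products of factors \<open>q\<close> and \<open>1 - q\<close>.\<close>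

lemma random_graph_pmf_measurable:
  assumes meas: "\<And>e. e \<in> vertex_pairs k \<Longrightarrow> (\<lambda>x. q x (fst e) (snd e)) \<in> borel_measurable N"
    and q: "\<And>x i j. 0 \<le> q x i j" "\<And>x i j. q x i j \<le> 1"
  shows "(\<lambda>x. measure_pmf (random_graph_pmf k (q x))) \<in> measurable N (subprob_algebra (count_space UNIV))"
proof (rule measurable_subprob_algebra)
  fix G :: "nat set set set"
  let ?F = "\<lambda>f. (\<lambda>(i, j). {i, j}) ` {e \<in> vertex_pairs k. f e}"
  let ?S = "PiE_dflt (vertex_pairs k) False (\<lambda>_. UNIV)"
  let ?P = "\<lambda>x. Pi_pmf (vertex_pairs k) False (\<lambda>(i, j). bernoulli_pmf (q x i j))"
  have S: "finite ?S" by (intro finite_PiE_dflt) auto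
  have "emeasure (measure_pmf (random_graph_pmf k (q x))) G =
    (\<Sum>f\<in>?S. indicator G (?F f) * ennreal (\<Prod>e\<in>vertex_pairs k. if f e then q x (fst e) (snd e) else 1 - q x (fst e) (snd e)))" for x
  proof -
    have "emeasure (measure_pmf (random_graph_pmf k (q x))) G = (\<integral>\<^sup>+f. indicator G (?F f) \<partial>?P x)"
      unfolding random_graph_pmf_def
      by (subst nn_integral_indicator[symmetric]) (simp_all add: nn_integral_map_pmf)
    also have "\<dots> = (\<Sum>f\<in>?S. indicator G (?F f) * ennreal (pmf (?P x) f))"
      using S set_Pi_pmf_subset[of "vertex_pairs k" False "\<lambda>(i, j). bernoulli_pmf (q x i j)"]
      by (intro nn_integral_measure_pmf_support) (auto simp: PiE_dflt_def)
    also have "\<dots> = (\<Sum>f\<in>?S. indicator G (?F f) * ennreal (\<Prod>e\<in>vertex_pairs k. if f e then q x (fst e) (snd e) else 1 - q x (fst e) (snd e)))"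
    proof (intro sum.cong refl arg_cong2[where f="(*)"] arg_cong[where f=ennreal])
      fix f assume "f \<in> ?S"
      then show "pmf (?P x) f = (\<Prod>e\<in>vertex_pairs k. if f e then q x (fst e) (snd e) else 1 - q x (fst e) (snd e))"
        by (subst pmf_Pi) (auto simp: PiE_dflt_def q case_prod_beta' intro!: prod.cong)
    qed
    finally show ?thesis .
  qed
  moreover have "(\<lambda>x. \<Sum>f\<in>?S. indicator G (?F f) * ennreal (\<Prod>e\<in>vertex_pairs k. if f e then q x (fst e) (snd e) else 1 - q x (fst e) (snd e))) \<in> borel_measurable N"
  proof (intro borel_measurable_sum borel_measurable_times_ennreal measurable_compose[OF _ measurable_ennreal] borel_measurable_prod)
    fix f and e assume e: "e \<in> vertex_pairs k"
    note [measurable] = meas[OF e]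
    show "(\<lambda>x. if f e then q x (fst e) (snd e) else 1 - q x (fst e) (snd e)) \<in> borel_measurable N"
      by (cases "f e") simp_all
  qed auto
  ultimately show "(\<lambda>x. emeasure (measure_pmf (random_graph_pmf k (q x))) G) \<in> borel_measurable N"
    by simp
qed (auto simp: subprob_space_measure_pmf)

text \<open>The preimages under \<open>f\<close> and \<open>g\<close> differ inside a null set, and
  the completion contains all subsets of null sets.\<close>

lemma measurable_completion_AE_cong:
  assumes f: "f \<in> measurable M N" and g: "\<And>x. x \<in> space M \<Longrightarrow> g x \<in> space N"
    and eq: "AE x in M. f x = g x"
  shows "g \<in> measurable (completion M) N"
proof (rule measurableI)
  fix A assume "A \<in> sets N"
  then have [measurable]: "Measurable.pred (completion M) (\<lambda>x. f x \<in> A)"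
    using measurable_completion[OF f] by measurable
  have [measurable]: "Measurable.pred (completion M) (\<lambda>x. f x \<in> A \<and> f x \<noteq> g x)"
    "Measurable.pred (completion M) (\<lambda>x. g x \<in> A \<and> f x \<noteq> g x)"
    using eq by (auto intro!: sets_completion_AE)
  have "Measurable.pred (completion M) (\<lambda>x. (f x \<in> A \<and> \<not> (f x \<in> A \<and> f x \<noteq> g x)) \<or> (g x \<in> A \<and> f x \<noteq> g x))"
    by measurable
  also have "(\<lambda>x. (f x \<in> A \<and> \<not> (f x \<in> A \<and> f x \<noteq> g x)) \<or> (g x \<in> A \<and> f x \<noteq> g x)) = (\<lambda>x. g x \<in> A)"
    by auto
  finally show "g -` A \<inter> space (completion M) \<in> sets (completion M)"
    by (simp add: pred_def vimage_def Int_def conj_commute)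
qed (use g in simp)

locale graphon_version = sym_graphon unit_interval u for u +
  fixes U :: "real \<Rightarrow> real \<Rightarrow> real"
  assumes U_eq: "AE z in unit_interval \<Otimes>\<^sub>M unit_interval. U (fst z) (snd z) = u (fst z) (snd z)"
begin

abbreviation points :: "nat \<Rightarrow> (nat \<Rightarrow> real) measure" where
  "points k \<equiv> Pi\<^sub>M {1..k} (\<lambda>_. unit_interval)"

lemma prob_space_points: "prob_space (points k)"
  by (intro prob_space_PiM prob_space_unit_interval)

lemma kernel_measurable:
  "(\<lambda>x. measure_pmf (random_graph_pmf k (\<lambda>i j. u (x i) (x j)))) \<in>
    measurable (points k) (subprob_algebra (count_space UNIV))"
proof (rule random_graph_pmf_measurable)
  fix e assume "e \<in> vertex_pairs k"
  then have [measurable]: "fst e \<in> {1..k}" "snd e \<in> {1..k}" by (auto simp: vertex_pairs_def)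
  have "(\<lambda>x. (x (fst e), x (snd e))) \<in> measurable (points k) (unit_interval \<Otimes>\<^sub>M unit_interval)"
    by measurable
  from measurable_compose[OF this u_measurable]
  show "(\<lambda>x. u (x (fst e)) (x (snd e))) \<in> borel_measurable (points k)" by simp
qed (auto simp: u_nonneg u_le_1)

text \<open>The kernels of \<open>U\<close> and \<open>u\<close> agree at almost every choice of
  points, and integrals with respect to the completion equal those with respect to the original
  measure. From here on only Borel functions are needed.\<close>

lemma graphon_sample_eq:
  "graphon_sample k U = points k \<bind> (\<lambda>x. measure_pmf (random_graph_pmf k (\<lambda>i j. u (x i) (x j))))"
proof -
  interpret P: prob_space "points k" by (rule prob_space_points)
  let ?K = "\<lambda>u x. measure_pmf (random_graph_pmf k (\<lambda>i j. u (x i) (x j)))"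
  have up: "uniform_points k = completion (points k)"
    by (simp add: uniform_points_def unit_interval_def)
  have eq: "AE x in points k. ?K u x = ?K U x"
    using AE_vertex_pairs[OF prob_space_unit_interval U_eq, of k]
    by eventually_elim (auto intro!: arg_cong[where f=measure_pmf] random_graph_pmf_cong)
  have meas: "?K U \<in> measurable (completion (points k)) (subprob_algebra (count_space UNIV))"
    by (rule measurable_completion_AE_cong[OF kernel_measurable _ eq]) (simp add: measure_pmf_in_subprob_algebra)
  show ?thesis
    unfolding graphon_sample_def up
  proof (rule measure_eqI)
    have s1: "sets (completion (points k) \<bind> ?K U) = sets (count_space UNIV)"
      by (rule sets_bind[OF sets_kernel[OF meas]]) (auto simp: P.not_empty)
    have s2: "sets (points k \<bind> ?K u) = sets (count_space UNIV)"
      by (rule sets_bind[OF sets_kernel[OF kernel_measurable]]) (auto simp: P.not_empty)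
    show "sets (completion (points k) \<bind> ?K U) = sets (points k \<bind> ?K u)"
      by (simp only: s1 s2)
    fix G
    have "emeasure (completion (points k) \<bind> ?K U) G = (\<integral>\<^sup>+x. emeasure (?K U x) G \<partial>completion (points k))"
      using P.not_empty by (intro emeasure_bind[OF _ meas]) auto
    also have "\<dots> = (\<integral>\<^sup>+x. emeasure (?K u x) G \<partial>points k)"
      unfolding nn_integral_completion
      by (rule nn_integral_cong_AE, use eq in eventually_elim) simp
    also have "\<dots> = emeasure (points k \<bind> ?K u) G"
      using P.not_empty by (intro emeasure_bind[OF _ kernel_measurable, symmetric]) auto
    finally show "emeasure (completion (points k) \<bind> ?K U) G = emeasure (points k \<bind> ?K u) G" .
  qed
qed

text \<open>The integrand is a product over all vertex pairs, with factor \<open>s\<close> for an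
  edge and \<open>t\<close> for a non-edge. Given the points, the pairs are independent, so the mean
  factorises into the means \<open>two_weight\<close>.\<close>

lemma edge_count_generating_function:
  assumes "0 \<le> s" "0 \<le> t"
  shows "(\<integral>\<^sup>+n. ennreal s ^ n * ennreal t ^ ((k choose 2) - n) \<partial>edge_count_distribution k U) =
    clique_density unit_interval (two_weight s t u) k"
proof -
  let ?K = "\<lambda>x. measure_pmf (random_graph_pmf k (\<lambda>i j. u (x i) (x j)))"
  let ?h = "\<lambda>n. ennreal s ^ n * ennreal t ^ ((k choose 2) - n)"
  have sets: "sets (graphon_sample k U) = sets (count_space UNIV)"
    unfolding graphon_sample_eq
    using prob_space.not_empty[OF prob_space_points[of k]]
    by (intro sets_bind[OF sets_kernel[OF kernel_measurable]]) auto
  have "(\<integral>\<^sup>+n. ?h n \<partial>edge_count_distribution k U) = (\<integral>\<^sup>+G. ?h (card G) \<partial>graphon_sample k U)"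
    unfolding edge_count_distribution_def
    by (rule nn_integral_distr) (auto simp: measurable_cong_sets[OF sets refl])
  also have "\<dots> = (\<integral>\<^sup>+x. \<integral>\<^sup>+G. ?h (card G) \<partial>?K x \<partial>points k)"
    unfolding graphon_sample_eq by (rule nn_integral_bind[OF _ kernel_measurable]) simp
  also have "\<dots> = (\<integral>\<^sup>+x. (\<Prod>e\<in>vertex_pairs k. two_weight s t u (x (fst e)) (x (snd e))) \<partial>points k)"
  proof (rule nn_integral_cong)
    fix x
    let ?F = "\<lambda>f. (\<lambda>(i, j). {i, j}) ` {e \<in> vertex_pairs k. f e}"
    let ?w = "\<lambda>e b. if b then ennreal s else ennreal t"
    have h: "?h (card (?F f)) = (\<Prod>e\<in>vertex_pairs k. ?w e (f e))" for f
    proof -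
      \<comment> \<open>Since \<open>i < j\<close> in every vertex pair, distinct pairs give
        distinct edges.\<close>
      have "card (?F f) = card {e \<in> vertex_pairs k. f e}"
        by (rule card_image) (auto simp: inj_on_def vertex_pairs_def doubleton_eq_iff)
      moreover have "(k choose 2) - card {e \<in> vertex_pairs k. f e} = card {e \<in> vertex_pairs k. \<not> f e}"
      proof -
        have "vertex_pairs k - {e \<in> vertex_pairs k. f e} = {e \<in> vertex_pairs k. \<not> f e}" by auto
        then show ?thesis by (metis (no_types, lifting) card_Diff_subset card_vertex_pairs finite_subset finite_vertex_pairs mem_Collect_eq subsetI)
      qed
      ultimately show ?thesis
        by (simp add: prod.If_cases Int_def)
    qed
    have "(\<integral>\<^sup>+G. ?h (card G) \<partial>?K x) =
      (\<integral>\<^sup>+f. (\<Prod>e\<in>vertex_pairs k. ?w e (f e)) \<partial>Pi_pmf (vertex_pairs k) False (\<lambda>(i, j). bernoulli_pmf (u (x i) (x j))))"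
      unfolding random_graph_pmf_def by (simp add: nn_integral_map_pmf h)
    also have "\<dots> = (\<Prod>e\<in>vertex_pairs k. two_weight s t u (x (fst e)) (x (snd e)))"
    proof (subst nn_integral_prod_Pi_pmf, simp, rule prod.cong[OF refl])
      fix e :: "nat \<times> nat"
      have "(\<integral>\<^sup>+b. ?w e b \<partial>bernoulli_pmf (u (x (fst e)) (x (snd e)))) =
        ennreal s * ennreal (u (x (fst e)) (x (snd e))) + ennreal t * ennreal (1 - u (x (fst e)) (x (snd e)))"
        by (subst nn_integral_bernoulli_pmf) (auto simp: u_nonneg u_le_1)
      also have "\<dots> = two_weight s t u (x (fst e)) (x (snd e))"
        using assms u_nonneg u_le_1
        by (simp add: two_weight_def ennreal_mult ennreal_plus)
      finally show "(\<integral>\<^sup>+b. ?w e b \<partial>measure_pmf (case e of (i, j) \<Rightarrow> bernoulli_pmf (u (x i) (x j)))) =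
        two_weight s t u (x (fst e)) (x (snd e))" by (simp add: case_prod_beta')
    qed
    finally show "(\<integral>\<^sup>+G. ?h (card G) \<partial>?K x) = (\<Prod>e\<in>vertex_pairs k. two_weight s t u (x (fst e)) (x (snd e)))" .
  qed
  finally show ?thesis by (simp add: clique_density_def)
qed

end

section \<open>Samples of step graphons\<close>

lemma distr_mem_eq:
  assumes "prob_space M" and [measurable]: "B \<in> sets M" "C \<in> sets M"
    and eq: "emeasure M B = emeasure M C"
  shows "distr M (count_space UNIV) (\<lambda>x. x \<in> B) = distr M (count_space UNIV) (\<lambda>x. x \<in> C)"
proof (rule measure_eqI_countable[of _ UNIV])
  interpret prob_space M by fact
  have compl: "emeasure M (space M - D) = 1 - emeasure M D" if "D \<in> sets M" for D
    using that by (subst emeasure_compl) (auto simp: emeasure_space_1)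
  have "emeasure (distr M (count_space UNIV) (\<lambda>x. x \<in> D)) {b} = (if b then emeasure M D else 1 - emeasure M D)"
    if [measurable]: "D \<in> sets M" for b D
  proof -
    have "(\<lambda>x. x \<in> D) -` {b} \<inter> space M = (if b then D else space M - D)"
      using sets.sets_into_space[OF that] by auto
    then show ?thesis by (simp add: emeasure_distr compl)
  qed
  then show "emeasure (distr M (count_space UNIV) (\<lambda>x. x \<in> B)) {b} = emeasure (distr M (count_space UNIV) (\<lambda>x. x \<in> C)) {b}"
    if "b \<in> UNIV" for b using eq by simp
qed auto

text \<open>The sample depends on the points only through their memberships in \<open>B\<close>.
  These are independent with success probability the measure of \<open>B\<close>, so sets of equal
  measure give equal samples, with no rearrangement of the interval.\<close>

lemma graphon_sample_step_eq:
  assumes "B \<in> sets borel" "C \<in> sets borel" and p: "0 \<le> p" "p \<le> 1"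
    and eq: "emeasure unit_interval B = emeasure unit_interval C"
    and U: "AE z in unit_interval \<Otimes>\<^sub>M unit_interval. U (fst z) (snd z) = step p (fst z \<in> B) (snd z \<in> B)"
    and V: "AE z in unit_interval \<Otimes>\<^sub>M unit_interval. V (fst z) (snd z) = step p (fst z \<in> C) (snd z \<in> C)"
  shows "graphon_sample k U = graphon_sample k V"
proof -
  let ?K = "\<lambda>y. measure_pmf (random_graph_pmf k (\<lambda>i j. step p (y i) (y j)))"
  let ?T = "Pi\<^sub>M {1..k} (\<lambda>_. count_space UNIV :: bool measure)"
  have K: "?K \<in> measurable ?T (subprob_algebra (count_space UNIV))"
  proof (rule random_graph_pmf_measurable)
    fix e assume "e \<in> vertex_pairs k"
    then have [measurable]: "fst e \<in> {1..k}" "snd e \<in> {1..k}" by (auto simp: vertex_pairs_def)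
    show "(\<lambda>y. step p (y (fst e)) (y (snd e))) \<in> borel_measurable ?T"
      unfolding step_def by measurable
  qed (use p in \<open>auto simp: step_def\<close>)
  have sample: "graphon_sample k W' =
      Pi\<^sub>M {1..k} (\<lambda>_. distr unit_interval (count_space UNIV) (\<lambda>x. x \<in> D)) \<bind> ?K"
    if D: "D \<in> sets borel" and W': "AE z in unit_interval \<Otimes>\<^sub>M unit_interval. W' (fst z) (snd z) = step p (fst z \<in> D) (snd z \<in> D)"
    for D and W' :: "real \<Rightarrow> real \<Rightarrow> real"
  proof -
    interpret graphon_version "\<lambda>x y. step p (x \<in> D) (y \<in> D)" W'
      using sym_graphon_step[OF prob_space_unit_interval _ p, of D] D W'
      by (simp add: graphon_version_def graphon_version_axioms_def sets_unit_interval)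
    interpret P: prob_space "points k" by (rule prob_space_points)
    have [measurable]: "D \<in> sets unit_interval" using D by (simp add: sets_unit_interval)
    \<comment> \<open>\<open>compose\<close> leaves the membership vector undefined outside
      \<open>{1..k}\<close>, as elements of the product space must be.\<close>
    let ?f = "compose {1..k} (\<lambda>x. x \<in> D)"
    have f: "?f \<in> measurable (points k) ?T"
      unfolding compose_def by measurable
    have "graphon_sample k W' = points k \<bind> (\<lambda>x. ?K (?f x))"
      unfolding graphon_sample_eq
      by (intro arg_cong2[where f=bind] ext arg_cong[where f=measure_pmf] refl random_graph_pmf_cong)
        (auto simp: compose_def vertex_pairs_def)
    also have "\<dots> = distr (points k) ?T ?f \<bind> ?K"
      using P.not_empty by (subst bind_distr[OF f K]) auto
    also have "distr (points k) ?T ?f = Pi\<^sub>M {1..k} (\<lambda>_. distr unit_interval (count_space UNIV) (\<lambda>x. x \<in> D))"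
    proof -
      let ?b = "distr unit_interval (count_space UNIV) (\<lambda>x. x \<in> D)"
      have "distr (points k) ?T ?f = distr (points k) (Pi\<^sub>M {1..k} (\<lambda>_. ?b)) ?f"
        by (rule distr_cong) (auto intro!: sets_PiM_cong)
      also have "\<dots> = Pi\<^sub>M {1..k} (\<lambda>_. distr unit_interval ?b (\<lambda>x. x \<in> D))"
        by (rule distr_PiM_finite_prob_space')
          (auto intro: prob_space_unit_interval prob_space.prob_space_distr[OF prob_space_unit_interval])
      also have "distr unit_interval ?b (\<lambda>x. x \<in> D) = ?b"
        by (rule distr_cong) auto
      finally show ?thesis .
    qed
    finally show ?thesis .
  qed
  show ?thesis
    unfolding sample[OF assms(1) U] sample[OF assms(2) V]
    using distr_mem_eq[OF prob_space_unit_interval, of B C] assms(1,2) eq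
    by (simp add: sets_unit_interval)
qed

theorem corollary7:
  fixes a p :: real and W :: "real \<Rightarrow> real \<Rightarrow> real"
  assumes "a \<in> {0..1}" and "p \<in> {0..1}"
    and "graphon W"
    and "\<forall>x\<in>{0..1}. \<forall>y\<in>{0..1}.
           W x y = (if x \<in> {0..<a} \<and> y \<in> {0..<a} then 0
                    else if x \<in> {a..1} \<and> y \<in> {a..1} then 1
                    else p)"
  shows "forced_by_edge_counts W"
  unfolding forced_by_edge_counts_def
proof (intro allI impI)
  fix U assume "graphon U"
    and counts: "\<forall>k\<ge>1. edge_count_distribution k U = edge_count_distribution k W"
  have p: "0 \<le> p" "p \<le> 1" using assms by auto
  have eB: "emeasure unit_interval {a..1} = ennreal (1 - a)"
    using assms(1) by (simp add: unit_interval_def ennreal_divide_one)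
  have W: "AE z in unit_interval \<Otimes>\<^sub>M unit_interval. W (fst z) (snd z) = step p (fst z \<in> {a..1}) (snd z \<in> {a..1})"
    unfolding AE_unit_square_iff using assms(1,4) by (intro AE_I2) (auto simp: step_def)
  obtain u where "sym_graphon unit_interval u"
    and u: "AE z in unit_interval \<Otimes>\<^sub>M unit_interval. U (fst z) (snd z) = u (fst z) (snd z)"
    using ex_sym_graphon_AE_eq[OF \<open>graphon U\<close>] .
  then interpret u: graphon_version u U
    by (simp add: graphon_version_def graphon_version_axioms_def)
  interpret w: graphon_version "\<lambda>x y. step p (x \<in> {a..1}) (y \<in> {a..1})" W
    using sym_graphon_step[OF prob_space_unit_interval _ p, of "{a..1}"] W
    by (simp add: graphon_version_def graphon_version_axioms_def sets_unit_interval)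
  \<comment> \<open>The part where \<open>W\<close> is 1 has measure \<open>b = 1 - a\<close>; the
    form \<open>1 - (1 - a)\<close> matches the \<open>1 - b\<close> of
    \<open>step_if_clique_densities\<close>. Equal edge counts give equal generating functions, and
    that of \<open>W\<close> is computed from its blocks.\<close>
  have dens: "clique_density unit_interval (two_weight s t u) k =
      block_sum (ennreal (1 - (1 - a))) (ennreal (1 - a)) (ennreal t) (ennreal s) (ennreal (s * p + t * (1 - p))) k"
    if "0 \<le> s" "0 \<le> t" "k \<ge> 1" for s t k
    using counts that assms(1) eB p
      u.edge_count_generating_function[of s t k] w.edge_count_generating_function[of s t k]
      clique_density_step[OF prob_space_unit_interval, of "{a..1}" p "1 - a" s t k]
    by (simp add: sets_unit_interval)
  obtain B where B: "B \<in> sets unit_interval" "emeasure unit_interval B = ennreal (1 - a)"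
    and uB: "AE z in unit_interval \<Otimes>\<^sub>M unit_interval. u (fst z) (snd z) = step p (fst z \<in> B) (snd z \<in> B)"
    using u.step_if_clique_densities[OF p _ _ dens] assms(1) by auto
  have UB: "AE z in unit_interval \<Otimes>\<^sub>M unit_interval. U (fst z) (snd z) = step p (fst z \<in> B) (snd z \<in> B)"
    using u uB by eventually_elim simp
  show "weakly_isomorphic U W"
    unfolding weakly_isomorphic_def
    using graphon_sample_step_eq[OF _ _ p _ UB W] B eB by (simp add: sets_unit_interval)
qed

end
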